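(* Let $T>0$ be a square-free integer and let $E$ be the elliptic curve over $\mathbb{Q}$ given by the Weierstrass equation $$E:\quad y^2=x^3-T^2x.$$ Suppose $P\in E(\mathbb{Q})$ is a non-torsion point, and let $B_{E,P}=(B_n)_{n\ge1}$ be the associated elliptic divisibility sequence. Then $$\mathsf Z_{\mathsf e}(B_{E,P})\le 10.$$ If moreover $x(P)<0$, then $\mathsf Z_{\mathsf o}(B_{E,P})\le 3$. If moreover $x(P)$ is the square of a rational number, then $\mathsf Z_{\mathsf o}(B_{E,P})\le 21$.
   Context: For a non-torsion point $P$ on an elliptic curve $E$ over $\mathbb{Q}$ given by a Weierstrass equation, and each integer $n\ge1$, write $x(nP)=A_n/B_n$ in lowest terms with $A_n\in\mathbb{Z}$, $B_n\in\mathbb{N}$; the sequence $B_{E,P}=(B_n)_{n\ge1}$ is called the elliptic divisibility sequence of $(E,P)$. For an integer sequence $A=(A_n)_{n\ge1}$, a prime $p$ dividing $A_n$ is a primitive divisor of $A_n$ if $p$ divides no $A_m$ with $1\le m<n$. The even Zsigmondy bound $\mathsf Z_{\mathsf e}(A)$ is the maximum of the set $\{2n : A_{2n}\text{ has no primitive divisor}\}$ if this set is finite, and $\infty$ otherwise; the odd Zsigmondy bound $\mathsf Z_{\mathsf o}(A)$ is the maximum of $\{2n-1 : A_{2n-1}\text{ has no primitive divisor}\}$ if this set is finite, and $\infty$ otherwise. *)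

theory Defs
  imports Complex_Main "HOL-Library.Extended_Nat" "HOL-Computational_Algebra.Computational_Algebra"
begin

text \<open>\<open>Weierstrass a1 a2 a3 a4 a6\<close> stands for the equation
  \<open>y^2 + a1 x y + a3 y = x^3 + a2 x^2 + a4 x + a6\<close>.\<close>

datatype 'a weierstrass = Weierstrass 'a 'a 'a 'a 'a

datatype 'a point = Infinity | Affine 'a 'a

fun discriminant :: "'a::field weierstrass \<Rightarrow> 'a" where
  "discriminant (Weierstrass a1 a2 a3 a4 a6) =
    (let b2 = a1^2 + 4 * a2;
         b4 = 2 * a4 + a1 * a3;
         b6 = a3^2 + 4 * a6;
         b8 = a1^2 * a6 + 4 * a2 * a6 - a1 * a3 * a4 + a2 * a3^2 - a4^2
     in - (b2^2 * b8) - 8 * b4^3 - 27 * b6^2 + 9 * b2 * b4 * b6)"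

definition elliptic :: "'a::field weierstrass \<Rightarrow> bool" where
  "elliptic E \<longleftrightarrow> discriminant E \<noteq> 0"

fun on_curve :: "'a::field weierstrass \<Rightarrow> 'a point \<Rightarrow> bool" where
  "on_curve E Infinity \<longleftrightarrow> True"
| "on_curve (Weierstrass a1 a2 a3 a4 a6) (Affine x y) \<longleftrightarrow>
    y^2 + a1 * x * y + a3 * y = x^3 + a2 * x^2 + a4 * x + a6"

text \<open>The chord-and-tangent law. Two points on the curve with the same
  \<open>x\<close>-coordinate are either mutually inverse or equal, so in the tangent case
  the slope may be computed from the first point alone.\<close>

fun point_add :: "'a::field weierstrass \<Rightarrow> 'a point \<Rightarrow> 'a point \<Rightarrow> 'a point" where
  "point_add E Infinity Q = Q"
| "point_add E (Affine x1 y1) Infinity = Affine x1 y1"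
| "point_add (Weierstrass a1 a2 a3 a4 a6) (Affine x1 y1) (Affine x2 y2) =
    (if x1 = x2 \<and> y1 + y2 + a1 * x2 + a3 = 0 then Infinity
     else
       let l = (if x1 = x2
                then (3 * x1^2 + 2 * a2 * x1 + a4 - a1 * y1) / (2 * y1 + a1 * x1 + a3)
                else (y2 - y1) / (x2 - x1));
           x3 = l^2 + a1 * l - a2 - x1 - x2
       in Affine x3 (- (l + a1) * x3 - (y1 - l * x1) - a3))"

primrec point_mult :: "'a::field weierstrass \<Rightarrow> nat \<Rightarrow> 'a point \<Rightarrow> 'a point" where
  "point_mult E 0 P = Infinity"
| "point_mult E (Suc n) P = point_add E P (point_mult E n P)"

definition torsion :: "'a::field weierstrass \<Rightarrow> 'a point \<Rightarrow> bool" where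
  "torsion E P \<longleftrightarrow> (\<exists>n\<ge>1. point_mult E n P = Infinity)"

text \<open>The point at infinity has no \<open>x\<close>-coordinate; its value there is unspecified.\<close>

primrec x_coord :: "'a point \<Rightarrow> 'a" where
  "x_coord (Affine x y) = x"

text \<open>\<open>quotient_of\<close> yields numerator and positive denominator in lowest terms.
  The value 0 is a convention for multiples equal to the point at infinity; for
  non-torsion \<open>P\<close> this occurs at index 0 only.\<close>

definition ell_div_seq :: "rat weierstrass \<Rightarrow> rat point \<Rightarrow> nat \<Rightarrow> int" where
  "ell_div_seq E P n =
    (case point_mult E n P of Infinity \<Rightarrow> 0 | Affine x y \<Rightarrow> snd (quotient_of x))"

text \<open>Sequences are indexed from 1; the entry at index 0 is ignored.\<close>

definition primitive_divisor :: "(nat \<Rightarrow> int) \<Rightarrow> nat \<Rightarrow> int \<Rightarrow> bool" where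
  "primitive_divisor A n p \<longleftrightarrow>
    prime p \<and> p dvd A n \<and> (\<forall>m. 1 \<le> m \<and> m < n \<longrightarrow> \<not> p dvd A m)"

text \<open>The maximum of the empty set is taken to be 0.\<close>

definition max_or_infinity :: "nat set \<Rightarrow> enat" where
  "max_or_infinity S =
    (if S = {} then 0 else if finite S then enat (Max S) else \<infinity>)"

definition zsigmondy_even :: "(nat \<Rightarrow> int) \<Rightarrow> enat" where
  "zsigmondy_even A =
    max_or_infinity {2 * n | n. 1 \<le> n \<and> \<not> (\<exists>p. primitive_divisor A (2 * n) p)}"

definition zsigmondy_odd :: "(nat \<Rightarrow> int) \<Rightarrow> enat" where
  "zsigmondy_odd A =
    max_or_infinity {2 * n - 1 | n. 1 \<le> n \<and> \<not> (\<exists>p. primitive_divisor A (2 * n - 1) p)}"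

definition congruent_number_curve :: "int \<Rightarrow> rat weierstrass" where
  "congruent_number_curve T = Weierstrass 0 0 0 (- (of_int T ^ 2)) 0"

lemma on_congruent_number_curve:
  "on_curve (congruent_number_curve T) (Affine x y) \<longleftrightarrow> y^2 = x^3 - (of_int T)^2 * x"
  by (simp add: congruent_number_curve_def)

lemma elliptic_congruent_number_curve:
  "T \<noteq> 0 \<Longrightarrow> elliptic (congruent_number_curve T)"
  by (simp add: elliptic_def congruent_number_curve_def)

end

theory Submission
  imports Defs "HOL-Analysis.Harmonic_Numbers"
begin

text \<open>
  Only \<open>x\<close>-coordinates are used. The reciprocals \<open>t\<^sub>n = 1/x(nP)\<close> satisfy
  \<open>t\<^sub>m\<^sub>+\<^sub>n + t\<^sub>m\<^sub>-\<^sub>n = 2 (t\<^sub>m + t\<^sub>n) (1 - T\<^sup>2 t\<^sub>m t\<^sub>n) / (1 + T\<^sup>2 t\<^sub>m t\<^sub>n)\<^sup>2\<close> and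
  \<open>t\<^sub>m\<^sub>+\<^sub>n t\<^sub>m\<^sub>-\<^sub>n = ((t\<^sub>m - t\<^sub>n) / (1 + T\<^sup>2 t\<^sub>m t\<^sub>n))\<^sup>2\<close>; the case \<open>n = 1\<close> is read off the chord-tangent law
  and the general case follows by induction, without associativity. These relations show that
  the indices \<open>n\<close> with \<open>p | B\<^sub>n\<close> are the multiples of the least one, and that \<open>B\<^sub>q\<^sub>n\<close> gains at most a
  factor \<open>q\<^sup>2\<close> at the primes dividing \<open>B\<^sub>n\<close>. Hence \<open>B\<^sub>n\<close> divides the product of \<open>q\<^sup>2 B\<^sub>n\<^sub>/\<^sub>q\<close> over the primes
  \<open>q | n\<close> if it has no primitive divisor.

  The numerators \<open>H\<^sub>n = A\<^sub>2\<^sub>n\<close> serve as heights. Doubled points reduce to nonsingular points at every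
  prime, so nothing cancels in the product relation, and
  \<open>H\<^sub>m\<^sub>+\<^sub>n H\<^sub>m\<^sub>-\<^sub>n = (A\<^sub>2\<^sub>m A\<^sub>2\<^sub>n + T\<^sup>2 B\<^sub>2\<^sub>m B\<^sub>2\<^sub>n)\<^sup>2 \<ge> (H\<^sub>m H\<^sub>n)\<^sup>2\<close>; this gives \<open>H\<^sub>q\<^sub>m \<ge> H\<^sub>m\<^sup>q\<^sup>*\<^sup>q\<close> with no error term.
  A resultant bounds \<open>B\<^sub>m\<close> above by \<open>H\<^sub>m\<^sup>1\<^sup>/\<^sup>4\<close>, and \<open>B\<^sub>n\<close> is at least about \<open>H\<^sub>n\<^sup>1\<^sup>/\<^sup>8\<close> when \<open>x(nP)\<close> is a
  square and \<open>H\<^sub>n\<^sup>1\<^sup>/\<^sup>4\<close> when \<open>x(nP) < 0\<close>. All factors involving \<open>T\<close> are absorbed by \<open>4 T \<le> H\<^sub>1\<close>, so for large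
  \<open>n\<close> these bounds contradict the divisibility because the sum of \<open>1/q\<^sup>2\<close> over primes is less than \<open>1/2\<close>.
\<close>

section \<open>Addition of reciprocal x-coordinates\<close>

text \<open>In the induction step, \<open>a = t\<^sub>m\<close>, \<open>b = t\<^sub>n\<close>, \<open>c = t\<^sub>1\<close>, the pair \<open>x, x'\<close> is \<open>t\<^sub>m\<^sub>+\<^sub>n, t\<^sub>m\<^sub>-\<^sub>n\<close> and \<open>y, y'\<close> is
  \<open>t\<^sub>n\<^sub>+\<^sub>1, t\<^sub>n\<^sub>-\<^sub>1\<close>. The following identities say that expressions in the values at \<open>\<plusminus>m \<plusminus> n \<plusminus> 1\<close> do not depend
  on the bracketing.\<close>

lemma sum_of_sums_identity:
  fixes x x' s p a b c k d :: "'a::field"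
  assumes s: "s * d\<^sup>2 = 2 * (a + b) * (1 - k * a * b)" and p: "p * d\<^sup>2 = (a - b)\<^sup>2" and d: "d = 1 + k * a * b"
    and x: "s = x + x'" "p = x * x'"
  shows "((x + c) * (1 - k * x * c) * (1 + k * x' * c)\<^sup>2 + (x' + c) * (1 - k * x' * c) * (1 + k * x * c)\<^sup>2) * d ^ 4
    = 2 * c * d ^ 4 + 2 * k * c\<^sup>2 * (2 * (a + b) * (1 - k * a * b)) * d\<^sup>2
     + k\<^sup>2 * c ^ 3 * ((2 * (a + b) * (1 - k * a * b))\<^sup>2 - 2 * (a - b)\<^sup>2 * d\<^sup>2)
     + (1 - k * c\<^sup>2) * (2 * (a + b) * (1 - k * a * b)) * d\<^sup>2
     + 4 * k * c * (1 - k * c\<^sup>2) * (a - b)\<^sup>2 * d\<^sup>2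
     + ((1 - k * c\<^sup>2) * k\<^sup>2 * c\<^sup>2 - 2 * k\<^sup>2 * c\<^sup>2) * (a - b)\<^sup>2 * (2 * (a + b) * (1 - k * a * b))
     - k * c * ((2 * (a + b) * (1 - k * a * b))\<^sup>2 - 2 * (a - b)\<^sup>2 * d\<^sup>2)
     - 2 * k ^ 3 * c ^ 3 * (a - b) ^ 4" (is "?l * d ^ 4 = _")
proof -
  \<comment> \<open>The expression is symmetric in \<open>x\<close> and \<open>x'\<close>, hence a
    polynomial in their sum \<open>s\<close> and product \<open>p\<close>; the factor
    \<open>d ^ 4\<close> then clears the denominators of \<open>s\<close> and
    \<open>p\<close>.\<close>
  have l: "?l = 2 * c + 2 * k * c\<^sup>2 * s + k\<^sup>2 * c ^ 3 * (s\<^sup>2 - 2 * p) + (1 - k * c\<^sup>2) * s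
     + 4 * k * c * (1 - k * c\<^sup>2) * p
     + ((1 - k * c\<^sup>2) * k\<^sup>2 * c\<^sup>2 - 2 * k\<^sup>2 * c\<^sup>2) * p * s
     - k * c * (s\<^sup>2 - 2 * p) - 2 * k ^ 3 * c ^ 3 * p\<^sup>2"
    unfolding x by algebra
  have p4: "(a - b) ^ 4 = (p * d\<^sup>2)\<^sup>2"
    unfolding p by algebra
  show ?thesis
    unfolding l p4 s[symmetric] p[symmetric] by algebra
qed

lemma denominators_symmetric:
  fixes x x' y y' a b c k :: "'a::field"
  assumes "(x + x') * (1 + k * a * b)\<^sup>2 = 2 * (a + b) * (1 - k * a * b)"
    "x * x' * (1 + k * a * b)\<^sup>2 = (a - b)\<^sup>2"
    "(y + y') * (1 + k * b * c)\<^sup>2 = 2 * (b + c) * (1 - k * b * c)"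
    "y * y' * (1 + k * b * c)\<^sup>2 = (b - c)\<^sup>2"
  shows "(1 + k * x * c) * (1 + k * x' * c) * (1 + k * a * b)\<^sup>2
     = (1 + k * a * y) * (1 + k * a * y') * (1 + k * b * c)\<^sup>2"
proof -
  have 1: "(1 + k * x * c) * (1 + k * x' * c) * (1 + k * a * b)\<^sup>2 = (1 + k * a * b)\<^sup>2 + k * c * ((x + x') * (1 + k * a * b)\<^sup>2)
    + k\<^sup>2 * c\<^sup>2 * (x * x' * (1 + k * a * b)\<^sup>2)" by algebra
  have 2: "(1 + k * a * y) * (1 + k * a * y') * (1 + k * b * c)\<^sup>2 = (1 + k * b * c)\<^sup>2 + k * a * ((y + y') * (1 + k * b * c)\<^sup>2)
    + k\<^sup>2 * a\<^sup>2 * (y * y' * (1 + k * b * c)\<^sup>2)" by algebra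
  show ?thesis unfolding 1 2 assms by algebra
qed

lemma numerators_symmetric:
  fixes x x' y y' a b c k :: "'a::field"
  assumes "(x + x') * (1 + k * a * b)\<^sup>2 = 2 * (a + b) * (1 - k * a * b)"
    "x * x' * (1 + k * a * b)\<^sup>2 = (a - b)\<^sup>2"
    "(y + y') * (1 + k * b * c)\<^sup>2 = 2 * (b + c) * (1 - k * b * c)"
    "y * y' * (1 + k * b * c)\<^sup>2 = (b - c)\<^sup>2"
  shows "(x - c) * (x' - c) * (1 + k * a * b)\<^sup>2 = (a - y) * (a - y') * (1 + k * b * c)\<^sup>2"
proof -
  have 1: "(x - c) * (x' - c) * (1 + k * a * b)\<^sup>2 = (x * x' * (1 + k * a * b)\<^sup>2) - c * ((x + x') * (1 + k * a * b)\<^sup>2)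
    + c\<^sup>2 * (1 + k * a * b)\<^sup>2" by algebra
  have 2: "(a - y) * (a - y') * (1 + k * b * c)\<^sup>2 = (y * y' * (1 + k * b * c)\<^sup>2) - a * ((y + y') * (1 + k * b * c)\<^sup>2)
    + a\<^sup>2 * (1 + k * b * c)\<^sup>2" by algebra
  show ?thesis unfolding 1 2 assms by algebra
qed

lemma sums_symmetric:
  fixes x x' y y' a b c k :: "'a::field"
  assumes h1: "(x + x') * (1 + k * a * b)\<^sup>2 = 2 * (a + b) * (1 - k * a * b)"
    and h2: "x * x' * (1 + k * a * b)\<^sup>2 = (a - b)\<^sup>2"
    and h3: "(y + y') * (1 + k * b * c)\<^sup>2 = 2 * (b + c) * (1 - k * b * c)"
    and h4: "y * y' * (1 + k * b * c)\<^sup>2 = (b - c)\<^sup>2"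
  shows "((x + c) * (1 - k * x * c) * (1 + k * x' * c)\<^sup>2 + (x' + c) * (1 - k * x' * c) * (1 + k * x * c)\<^sup>2) * (1 + k * a * b) ^ 4
    = ((a + y) * (1 - k * a * y) * (1 + k * a * y')\<^sup>2 + (a + y') * (1 - k * a * y') * (1 + k * a * y)\<^sup>2) * (1 + k * b * c) ^ 4"
proof -
  have h3': "(y + y') * (1 + k * b * c)\<^sup>2 = 2 * (b + c) * (1 - k * b * c)"
    and h4': "y * y' * (1 + k * b * c)\<^sup>2 = (b - c)\<^sup>2" using h3 h4 by auto
  \<comment> \<open>Both sides become values of one polynomial, at \<open>(a, b; c)\<close> and at
    \<open>(b, c; a)\<close>. Once expanded, it is symmetric in all three arguments.\<close>
  note e1 = sum_of_sums_identity[OF h1 h2 refl refl refl, of c]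
  note e2 = sum_of_sums_identity[OF h3' h4' refl refl refl, of a]
  have e3: "(a + y) * (1 - k * a * y) * (1 + k * a * y')\<^sup>2 + (a + y') * (1 - k * a * y') * (1 + k * a * y)\<^sup>2
    = (y + a) * (1 - k * y * a) * (1 + k * y' * a)\<^sup>2 + (y' + a) * (1 - k * y' * a) * (1 + k * y * a)\<^sup>2"
    by algebra
  show ?thesis unfolding e3 e1 e2 by algebra
qed

text \<open>Only steps by the index 1 are assumed, since these are what the chord-tangent law gives
  directly. The value 0 at index 0 stands for the point at infinity.\<close>

locale kummer_sequence =
  fixes t :: "nat \<Rightarrow> 'a::field" and k :: 'a
  assumes t_0: "t 0 = 0"
    and t_nonzero: "0 < n \<Longrightarrow> t n \<noteq> 0"
    and step_denominator: "0 < n \<Longrightarrow> 1 + k * t n * t 1 \<noteq> 0"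
    and step_sum: "0 < n \<Longrightarrow> (t (n + 1) + t (n - 1)) * (1 + k * t n * t 1)\<^sup>2 = 2 * (t n + t 1) * (1 - k * t n * t 1)"
    and step_product: "0 < n \<Longrightarrow> t (n + 1) * t (n - 1) * (1 + k * t n * t 1)\<^sup>2 = (t n - t 1)\<^sup>2"
begin

text \<open>Two-step induction on \<open>n\<close>. The steps from \<open>m + n\<close> and from
  \<open>m - n\<close> give the values at \<open>m \<plusminus> n \<plusminus> 1\<close>. Of these
  four, \<open>H\<close> and \<open>H'\<close> sit at \<open>m \<plusminus> (n - 1)\<close> and are
  known from the induction hypothesis; cancelling their product and subtracting their sum leaves the
  relations for \<open>G\<close> and \<open>G'\<close> at
  \<open>m \<plusminus> (n + 1)\<close>.\<close>

lemma addition: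
  assumes "n \<le> m"
  shows "1 + k * t m * t n \<noteq> 0
    \<and> (t (m + n) + t (m - n)) * (1 + k * t m * t n)\<^sup>2 = 2 * (t m + t n) * (1 - k * t m * t n)
    \<and> t (m + n) * t (m - n) * (1 + k * t m * t n)\<^sup>2 = (t m - t n)\<^sup>2"
  using assms
proof (induction n arbitrary: m rule: induct_nat_012)
  case 0
  then show ?case by (simp add: t_0 power2_eq_square)
next
  case 1
  then show ?case using step_denominator[of m] step_sum[of m] step_product[of m] by simp
next
  case (ge2 j)
  define n where "n = Suc j"
  have n: "0 < n" "j = n - 1" "Suc (Suc j) = n + 1" by (simp_all add: n_def)
  have m: "0 < m - n" "0 < m + n" "n \<le> m" "n - 1 \<le> m" using ge2.prems n by auto
  have idx: "m - (n - 1) = m - n + 1" "m + (n - 1) = m + n - 1" "m - n - 1 = m - (n + 1)"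
    "m + n + 1 = m + (n + 1)"
    using m n by auto
  define a b c x x' y y' where v: "a = t m" "b = t n" "c = t 1" "x = t (m + n)" "x' = t (m - n)"
    "y = t (n + 1)" "y' = t (n - 1)"
  have h1: "(x + x') * (1 + k * a * b)\<^sup>2 = 2 * (a + b) * (1 - k * a * b)"
    and h2: "x * x' * (1 + k * a * b)\<^sup>2 = (a - b)\<^sup>2" and dab: "1 + k * a * b \<noteq> 0"
    using ge2.IH(2)[of m] m(3) by (simp_all add: v n_def)
  have h3: "(y + y') * (1 + k * b * c)\<^sup>2 = 2 * (b + c) * (1 - k * b * c)"
    and h4: "y * y' * (1 + k * b * c)\<^sup>2 = (b - c)\<^sup>2" and dbc: "1 + k * b * c \<noteq> 0"
    using step_sum[OF n(1)] step_product[OF n(1)] step_denominator[OF n(1)] by (simp_all add: v)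
  define G G' H H' where w: "G = t (m + (n + 1))" "G' = t (m - (n + 1))" "H = t (m + n - 1)" "H' = t (m - n + 1)"
  have s1: "(G + H) * (1 + k * x * c)\<^sup>2 = 2 * (x + c) * (1 - k * x * c)"
    and p1: "G * H * (1 + k * x * c)\<^sup>2 = (x - c)\<^sup>2" and dx: "1 + k * x * c \<noteq> 0"
    using step_sum[OF m(2)] step_product[OF m(2)] step_denominator[OF m(2)] unfolding idx
    by (simp_all add: v w)
  have s2: "(H' + G') * (1 + k * x' * c)\<^sup>2 = 2 * (x' + c) * (1 - k * x' * c)"
    and p2: "H' * G' * (1 + k * x' * c)\<^sup>2 = (x' - c)\<^sup>2" and dx': "1 + k * x' * c \<noteq> 0"
    using step_sum[OF m(1)] step_product[OF m(1)] step_denominator[OF m(1)] unfolding idx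
    by (simp_all add: v w)
  have s3: "(H + H') * (1 + k * a * y')\<^sup>2 = 2 * (a + y') * (1 - k * a * y')"
    and p3: "H * H' * (1 + k * a * y')\<^sup>2 = (a - y')\<^sup>2" and day': "1 + k * a * y' \<noteq> 0"
    using ge2.IH(1)[of m] m(4) unfolding n(2) idx by (simp_all add: v w)
  have HH: "H * H' \<noteq> 0" using m n by (simp add: w t_nonzero)
  define p q r u z where d: "p = 1 + k * x * c" "q = 1 + k * x' * c" "r = 1 + k * a * b" "u = 1 + k * a * y"
     "z = 1 + k * a * y'"
  define e where e: "e = 1 + k * b * c"
  \<comment> \<open>Besides matching denominators, this transfers non-vanishing from
    \<open>p\<close>, \<open>q\<close>, \<open>r\<close> to the new denominator
    \<open>u\<close>.\<close>
  have D: "p * q * r\<^sup>2 = u * z * e\<^sup>2"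
    using denominators_symmetric[OF h1 h2 h3 h4] by (simp add: d e)
  have day: "u \<noteq> 0"
    using D dx dx' dab by (auto simp: d)
  have M: "(x - c) * (x' - c) * r\<^sup>2 = (a - y) * (a - y') * e\<^sup>2"
    using numerators_symmetric[OF h1 h2 h3 h4] by (simp add: d e)
  have S: "((x + c) * (1 - k * x * c) * q\<^sup>2 + (x' + c) * (1 - k * x' * c) * p\<^sup>2) * r ^ 4
    = ((a + y) * (1 - k * a * y) * z\<^sup>2 + (a + y') * (1 - k * a * y') * u\<^sup>2) * e ^ 4"
    using sums_symmetric[OF h1 h2 h3 h4] by (simp add: d e)
  have nz: "e \<noteq> 0" "z \<noteq> 0" using dbc day' by (simp_all add: d e)
  have "G * G' * u\<^sup>2 * (H * H' * z\<^sup>2 * e ^ 4) = (G * G') * (H * H') * (u * z * e\<^sup>2)\<^sup>2"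
    by algebra
  also have "\<dots> = (G * H * p\<^sup>2) * (H' * G' * q\<^sup>2) * r ^ 4"
    unfolding D[symmetric] by algebra
  also have "\<dots> = ((x - c) * (x' - c) * r\<^sup>2)\<^sup>2"
    using p1 p2 unfolding d by algebra
  also have "\<dots> = (a - y)\<^sup>2 * ((a - y')\<^sup>2 * e ^ 4)"
    unfolding M by algebra
  also have "\<dots> = (a - y)\<^sup>2 * (H * H' * z\<^sup>2 * e ^ 4)"
    using p3 by (simp add: d)
  finally have P: "G * G' * u\<^sup>2 = (a - y)\<^sup>2"
    using HH nz by simp
  have "(G + G') * u\<^sup>2 * (z\<^sup>2 * e ^ 4) + ((H + H') * z\<^sup>2) * (u\<^sup>2 * e ^ 4)
      = ((G + H) + (H' + G')) * (u * z * e\<^sup>2)\<^sup>2"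
    by algebra
  also have "\<dots> = (((G + H) * p\<^sup>2) * q\<^sup>2 + ((H' + G') * q\<^sup>2) * p\<^sup>2) * r ^ 4"
    unfolding D[symmetric] by algebra
  also have "\<dots> = 2 * (((x + c) * (1 - k * x * c) * q\<^sup>2 + (x' + c) * (1 - k * x' * c) * p\<^sup>2) * r ^ 4)"
    unfolding s1[folded d] s2[folded d] by algebra
  also have "\<dots> = (2 * (a + y) * (1 - k * a * y)) * (z\<^sup>2 * e ^ 4) + ((H + H') * z\<^sup>2) * (u\<^sup>2 * e ^ 4)"
    unfolding S s3[folded d] by algebra
  finally have "(G + G') * u\<^sup>2 = 2 * (a + y) * (1 - k * a * y)"
    using nz by simp
  with P day show ?case unfolding n(3) by (simp add: d v w)
qed

end

text \<open>The reciprocal of \<open>x\<close> vanishes at infinity, so index 0 obeys the same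
  relations as the others; the case split is needed because \<open>x_coord Infinity\<close> is
  unspecified.\<close>

definition inverse_x :: "rat weierstrass \<Rightarrow> rat point \<Rightarrow> nat \<Rightarrow> rat" where
  "inverse_x E P n = (if n = 0 then 0 else inverse (x_coord (point_mult E n P)))"

section \<open>The chord-and-tangent law on the congruent number curve\<close>

locale congruent_point =
  fixes T :: int and P :: "rat point"
  assumes T_pos: "T > 0"
    and on_curve_P: "on_curve (congruent_number_curve T) P"
    and nontorsion: "\<not> torsion (congruent_number_curve T) P"
begin

abbreviation "E \<equiv> congruent_number_curve T"
definition Q :: "nat \<Rightarrow> rat point" where "Q n = point_mult E n P"
definition X :: "nat \<Rightarrow> rat" where "X n = x_coord (Q n)"

definition k :: rat where "k = (of_int T)\<^sup>2"

lemma k_pos: "k > 0" using T_pos by (simp add: k_def)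

lemma on_curve_affine: "on_curve E (Affine x y) \<longleftrightarrow> y\<^sup>2 = x ^ 3 - k * x"
  by (simp add: on_congruent_number_curve k_def)

lemma multiple_affine: "0 < n \<Longrightarrow> Q n \<noteq> Infinity"
  using nontorsion by (auto simp: torsion_def Q_def)

lemma point_add_Infinity: "point_add E R Infinity = R"
  by (cases R) (simp_all add: congruent_number_curve_def)

lemma Q_1: "Q 1 = P"
  by (simp add: Q_def point_add_Infinity)

lemma Q_Suc: "Q (Suc n) = point_add E P (Q n)"
  by (simp add: Q_def)

lemma point_add_affine:
  assumes "point_add E (Affine x y) (Affine a b) = Affine x' y'"
  obtains l where "x' = l\<^sup>2 - x - a" "y' = - y - l * (x' - x)" "\<not> (x = a \<and> y + b = 0)"
    "l = (if x = a then (3 * x\<^sup>2 - k) / (2 * y) else (b - y) / (a - x))"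
proof -
  have ne: "\<not> (x = a \<and> y + b = 0)"
    using assms by (auto simp: congruent_number_curve_def)
  define l where "l = (if x = a then (3 * x\<^sup>2 - k) / (2 * y) else (b - y) / (a - x))"
  have "Affine x' y' = (let x3 = l\<^sup>2 - x - a in Affine x3 (- l * x3 - (y - l * x)))"
    unfolding assms[symmetric] using ne
    by (simp add: congruent_number_curve_def k_def l_def Let_def)
  then have "x' = l\<^sup>2 - x - a" "y' = - l * x' - (y - l * x)"
    by (simp_all add: Let_def)
  then have "x' = l\<^sup>2 - x - a \<and> y' = - y - l * (x' - x)"
    by algebra
  then show thesis using ne l_def that by blast
qed

text \<open>Substituting the line of slope \<open>l\<close> through \<open>(x, y)\<close> into the
  cubic and dividing out the known root \<open>x\<close> leaves a quadratic in the abscissa. The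
  second intersection point makes \<open>a\<close> a root of it, in the tangent case as
  well.\<close>

lemma slope_root:
  fixes x y a b l :: rat
  assumes "y\<^sup>2 = x ^ 3 - k * x" "b\<^sup>2 = a ^ 3 - k * a" "\<not> (x = a \<and> y + b = 0)"
    and l: "l = (if x = a then (3 * x\<^sup>2 - k) / (2 * y) else (b - y) / (a - x))"
  shows "a\<^sup>2 + (x - l\<^sup>2) * a + x\<^sup>2 - k - 2 * l * y + l\<^sup>2 * x = 0" "l * (a - x) = b - y"
proof -
  have "a\<^sup>2 + (x - l\<^sup>2) * a + x\<^sup>2 - k - 2 * l * y + l\<^sup>2 * x = 0 \<and> l * (a - x) = b - y"
  proof (cases "x = a")
    case True
    then have "y\<^sup>2 = b\<^sup>2" using assms by simp
    then have "y = b" using assms(3) True power2_eq_iff[of y b] by auto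
    then have "y \<noteq> 0" using assms True by simp
    then have "l * (2 * y) = 3 * x\<^sup>2 - k" using l True by simp
    then show ?thesis using True \<open>y = b\<close> by (auto simp: power2_eq_square algebra_simps)
  next
    case False
    then have s: "l * (a - x) = b - y" using l by simp
    have "(a - x) * (a\<^sup>2 + (x - l\<^sup>2) * a + x\<^sup>2 - k - 2 * l * y + l\<^sup>2 * x)
      = a ^ 3 - x ^ 3 - k * (a - x) - 2 * y * (l * (a - x)) - (l * (a - x))\<^sup>2"
      by algebra
    also have "\<dots> = 0" unfolding s using assms(1,2) by algebra
    finally show ?thesis using False s by simp
  qed
  then show "a\<^sup>2 + (x - l\<^sup>2) * a + x\<^sup>2 - k - 2 * l * y + l\<^sup>2 * x = 0" "l * (a - x) = b - y" by auto
qed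

lemma on_curve_point_add:
  assumes "on_curve E R" "on_curve E S"
  shows "on_curve E (point_add E R S)"
proof (cases R; cases S; cases "point_add E R S")
  fix x y a b x' y'
  assume R: "R = Affine x y" and S: "S = Affine a b" and A: "point_add E R S = Affine x' y'"
  obtain l where l: "x' = l\<^sup>2 - x - a" "y' = - y - l * (x' - x)" "\<not> (x = a \<and> y + b = 0)"
    "l = (if x = a then (3 * x\<^sup>2 - k) / (2 * y) else (b - y) / (a - x))"
    using A R S point_add_affine by metis
  have c: "y\<^sup>2 = x ^ 3 - k * x" "b\<^sup>2 = a ^ 3 - k * a"
    using assms by (simp_all add: R S on_curve_affine)
  have "y'\<^sup>2 = x' ^ 3 - k * x'"
    using slope_root(1)[OF c l(3,4)] c(1) l(1,2) by algebra
  then show ?thesis by (simp add: A on_curve_affine)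
qed (use assms in \<open>auto simp: congruent_number_curve_def\<close>)

lemma on_curve_multiple: "on_curve E (Q n)"
proof (induction n)
  case 0
  then show ?case by (simp add: Q_def congruent_number_curve_def)
next
  case (Suc n)
  then show ?case by (simp add: Q_Suc on_curve_point_add on_curve_P)
qed

lemma multiple_cases:
  assumes "0 < n"
  obtains y where "Q n = Affine (X n) y" "y\<^sup>2 = X n ^ 3 - k * X n"
proof (cases "Q n")
  case Infinity
  then show ?thesis using multiple_affine assms by simp
next
  case (Affine x y)
  then show ?thesis using that on_curve_multiple[of n] by (simp add: on_curve_affine X_def)
qed

text \<open>As \<open>2P\<close> is not the point at infinity, \<open>y\<close> is nonzero, and the
  tangent slope gives the duplication formula.\<close>

lemma X_2: "X 1 ^ 3 - k * X 1 \<noteq> 0" "X 2 * (4 * (X 1 ^ 3 - k * X 1)) = ((X 1)\<^sup>2 + k)\<^sup>2"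
proof -
  obtain x y where 1: "P = Affine x y" "y\<^sup>2 = x ^ 3 - k * x"
    using multiple_cases[of 1] Q_1 by (metis zero_less_one)
  obtain x' y' where 2: "Q 2 = Affine x' y'"
    using multiple_cases[of 2] by (metis zero_less_numeral)
  have "point_add E (Affine x y) (Affine x y) = Affine x' y'"
    using 2 Q_1 1 Q_Suc[of 1] by (simp add: numeral_2_eq_2)
  then obtain l where l: "x' = l\<^sup>2 - x - x" "y + y \<noteq> 0" "l = (3 * x\<^sup>2 - k) / (2 * y)"
    using point_add_affine[of x y x y] by auto
  have ly: "l * (2 * y) = 3 * x\<^sup>2 - k" and y: "y \<noteq> 0" using l by auto
  have X1: "X 1 = x" "X 2 = x'" using Q_1 1 2 by (metis X_def x_coord.simps)+
  show "X 1 ^ 3 - k * X 1 \<noteq> 0" using y 1(2) X1 by auto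
  have "x' * (4 * y\<^sup>2) = (l * (2 * y))\<^sup>2 - 8 * x * y\<^sup>2" unfolding l(1) by algebra
  also have "\<dots> = (x\<^sup>2 + k)\<^sup>2" unfolding ly 1(2) by algebra
  finally show "X 2 * (4 * (X 1 ^ 3 - k * X 1)) = ((X 1)\<^sup>2 + k)\<^sup>2"
    unfolding X1 1(2) .
qed

text \<open>The line through \<open>P\<close>, \<open>(n-1)P\<close> and \<open>-nP\<close> expresses \<open>x((n-1)P)\<close> through \<open>nP\<close> and \<open>P\<close>,
  which replaces the associativity of the group law.\<close>

lemma X_step:
  assumes "2 \<le> n"
  shows "X n \<noteq> X 1"
    and "(X (n + 1) + X (n - 1)) * (X n - X 1)\<^sup>2 = 2 * (X n + X 1) * (X n * X 1 - k)"
    and "X (n + 1) * X (n - 1) * (X n - X 1)\<^sup>2 = (X n * X 1 + k)\<^sup>2"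
proof -
  obtain x y where P: "P = Affine x y" "y\<^sup>2 = x ^ 3 - k * x"
    using multiple_cases[of 1] Q_1 by (metis zero_less_one)
  have X1: "X 1 = x" using Q_1 P by (metis X_def x_coord.simps)
  have "y \<noteq> 0" using X_2(1) P(2) X1 by auto
  obtain b where n1: "Q (n - 1) = Affine (X (n - 1)) b" "b\<^sup>2 = X (n - 1) ^ 3 - k * X (n - 1)"
    using multiple_cases[of "n - 1"] assms by auto
  obtain y' where n: "Q n = Affine (X n) y'" "y'\<^sup>2 = X n ^ 3 - k * X n"
    using multiple_cases[of n] assms by auto
  obtain z where n2: "Q (n + 1) = Affine (X (n + 1)) z"
    using multiple_cases[of "n + 1"] assms by auto
  have "Q n = point_add E P (Q (n - 1))"
    using assms Q_Suc[of "n - 1"] by simp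
  then have "point_add E (Affine x y) (Affine (X (n - 1)) b) = Affine (X n) y'"
    using n n1 P by simp
  then obtain l where l: "X n = l\<^sup>2 - x - X (n - 1)" "y' = - y - l * (X n - x)"
    using point_add_affine[of x y "X (n - 1)" b] by metis
  have "point_add E (Affine x y) (Affine (X n) y') = Affine (X (n + 1)) z"
    using n n2 P Q_Suc[of n] by simp
  then obtain l' where l': "X (n + 1) = l'\<^sup>2 - x - X n" "\<not> (x = X n \<and> y + y' = 0)"
    "l' = (if x = X n then (3 * x\<^sup>2 - k) / (2 * y) else (y' - y) / (X n - x))"
    using point_add_affine[of x y "X n" y'] by metis
  \<comment> \<open>If \<open>x = X n\<close>, the formula for \<open>y'\<close> from the previous
    addition gives \<open>y + y' = 0\<close>, so the next multiple would be the point at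
    infinity.\<close>
  have ne: "x \<noteq> X n"
    using l'(2) l(2) by auto
  then show "X n \<noteq> X 1" using X1 by simp
  define a c d where v: "a = X (n - 1)" "c = X n" "d = X (n + 1)"
  \<comment> \<open>\<open>l'\<close> is the slope of the line through \<open>P\<close> and
    \<open>nP\<close>, and \<open>l\<close> that of the line through \<open>P\<close> and
    \<open>-nP\<close>. So the formulas for \<open>d\<close> and \<open>a\<close> differ only in the
    sign of \<open>y'\<close>, and sum and product involve only \<open>y'\<^sup>2\<close>.\<close>
  have m: "l' * (c - x) = y' - y" using l'(3) ne by (simp add: v)
  have m': "l * (c - x) = - y' - y" using l(2) by (simp add: v)
  have d1: "d * (c - x)\<^sup>2 = (y' - y)\<^sup>2 - (x + c) * (c - x)\<^sup>2"
    unfolding m[symmetric] using l'(1) unfolding v by algebra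
  have a1: "a * (c - x)\<^sup>2 = (y' + y)\<^sup>2 - (x + c) * (c - x)\<^sup>2"
  proof -
    have "a * (c - x)\<^sup>2 = (l * (c - x))\<^sup>2 - (x + c) * (c - x)\<^sup>2"
      using l(1) unfolding v by algebra
    then show ?thesis unfolding m' by algebra
  qed
  have n': "y'\<^sup>2 = c ^ 3 - k * c" using n v by simp
  show "(X (n + 1) + X (n - 1)) * (X n - X 1)\<^sup>2 = 2 * (X n + X 1) * (X n * X 1 - k)"
    unfolding X1 v[symmetric] using d1 a1 n' P(2) by algebra
  have "d * a * (c - x)\<^sup>2 * (c - x)\<^sup>2 = (c * x + k)\<^sup>2 * (c - x)\<^sup>2"
  proof -
    have "d * a * (c - x)\<^sup>2 * (c - x)\<^sup>2 = (d * (c - x)\<^sup>2) * (a * (c - x)\<^sup>2)" by algebra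
    also have "\<dots> = (y'\<^sup>2 - y\<^sup>2)\<^sup>2 - 2 * (y'\<^sup>2 + y\<^sup>2) * ((x + c) * (c - x)\<^sup>2) + ((x + c) * (c - x)\<^sup>2)\<^sup>2"
      unfolding d1 a1 by algebra
    also have "\<dots> = (c * x + k)\<^sup>2 * (c - x)\<^sup>2" unfolding n' P(2) by algebra
    finally show ?thesis .
  qed
  then show "X (n + 1) * X (n - 1) * (X n - X 1)\<^sup>2 = (X n * X 1 + k)\<^sup>2"
    unfolding X1 v[symmetric] using ne by (simp add: v)
qed

text \<open>If \<open>X m = X n\<close>, the neighbours of \<open>m\<close> and those of
  \<open>n\<close> have the same sum and product, so \<open>X (n - 1)\<close> equals
  \<open>X (m + 1)\<close> or \<open>X (m - 1)\<close>. This contradicts the induction hypothesis at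
  \<open>n - 1\<close>.\<close>

lemma X_injective:
  assumes "0 < n" "n < m"
  shows "X m \<noteq> X n"
  using assms
proof (induction n arbitrary: m rule: less_induct)
  case (less n)
  show ?case
  proof (cases "n = 1")
    case True
    then show ?thesis using X_step(1)[of m] less.prems by simp
  next
    case False
    then have n: "2 \<le> n" "2 \<le> m" using less.prems by auto
    show ?thesis
    proof
      assume eq: "X m = X n"
      have s: "X (m + 1) + X (m - 1) = X (n + 1) + X (n - 1)"
        and p: "X (m + 1) * X (m - 1) = X (n + 1) * X (n - 1)"
        using X_step[OF n(1)] X_step[OF n(2)] unfolding eq
        by (metis mult_right_cancel right_minus_eq zero_eq_power2)+
      have "(X (n - 1) - X (m + 1)) * (X (n - 1) - X (m - 1)) = 0"
        using s p by algebra
      moreover have "X (m + 1) \<noteq> X (n - 1)" "X (m - 1) \<noteq> X (n - 1)"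
        using less.IH[of "n - 1" "m + 1"] less.IH[of "n - 1" "m - 1"] less.prems n by auto
      ultimately show False by simp
    qed
  qed
qed

text \<open>The abscissa 0 belongs to a point of order two, so adding and subtracting
  \<open>P\<close> there would give equal abscissas: the quadratic with roots
  \<open>X (n + 1)\<close> and \<open>X (n - 1)\<close> has discriminant zero. Injectivity forbids
  this.\<close>

lemma X_nonzero:
  assumes "0 < n"
  shows "X n \<noteq> 0"
proof (cases "n = 1")
  case True
  then show ?thesis using X_2(1) by auto
next
  case False
  then have n: "2 \<le> n" using assms by auto
  show ?thesis
  proof
    assume 0: "X n = 0"
    have X1: "X 1 \<noteq> 0" using X_step(1)[OF n] 0 by simp
    have e: "(X (n + 1) + X (n - 1)) * (X 1)\<^sup>2 = - 2 * X 1 * k"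
      "X (n + 1) * X (n - 1) * (X 1)\<^sup>2 = k\<^sup>2"
      using X_step(2,3)[OF n] 0 by simp_all
    have "(X (n + 1) - X (n - 1))\<^sup>2 * (X 1)\<^sup>2 * (X 1)\<^sup>2 = ((X (n + 1) + X (n - 1)) * (X 1)\<^sup>2)\<^sup>2 - 4 * (X (n + 1) * X (n - 1) * (X 1)\<^sup>2) * (X 1)\<^sup>2"
      by algebra
    also have "\<dots> = 0" unfolding e by algebra
    finally have "X (n + 1) = X (n - 1)" using X1 by simp
    moreover have "0 < n - 1" "n - 1 < n + 1" using n by auto
    ultimately show False using X_injective by blast
  qed
qed

abbreviation "t \<equiv> inverse_x E P"

lemma t_eq: "0 < n \<Longrightarrow> t n = inverse (X n)"
  by (simp add: inverse_x_def X_def Q_def)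

sublocale kummer_sequence t k
proof
  show "t 0 = 0" by (simp add: inverse_x_def)
next
  fix n :: nat assume "0 < n"
  then show "t n \<noteq> 0" using X_nonzero[of n] by (simp add: t_eq)
next
  fix n :: nat assume n: "0 < n"
  have X: "X n \<noteq> 0" "X 1 \<noteq> 0" using X_nonzero n by auto
  have t: "t n = inverse (X n)" "t 1 = inverse (X 1)" using n by (auto simp: t_eq)
  have d: "1 + k * t n * t 1 = (X n * X 1 + k) / (X n * X 1)"
    using X unfolding t by (simp add: field_simps)
  have d': "1 - k * t n * t 1 = (X n * X 1 - k) / (X n * X 1)"
    using X unfolding t by (simp add: field_simps)
  have "1 + k * t n * t 1 \<noteq> 0
    \<and> (t (n + 1) + t (n - 1)) * (1 + k * t n * t 1)\<^sup>2 = 2 * (t n + t 1) * (1 - k * t n * t 1)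
    \<and> t (n + 1) * t (n - 1) * (1 + k * t n * t 1)\<^sup>2 = (t n - t 1)\<^sup>2"
  proof (cases "n = 1")
    \<comment> \<open>Here the pair consists of \<open>2P\<close> and infinity, so the relations
      reduce to the duplication formula.\<close>
    case True
    define x where "x = X 1"
    have x: "x \<noteq> 0" "x ^ 3 - k * x \<noteq> 0" "X 2 * (4 * (x ^ 3 - k * x)) = (x\<^sup>2 + k)\<^sup>2" "X 2 \<noteq> 0"
      using X X_2 X_nonzero[of 2] by (simp_all add: x_def)
    have x2: "x * x + k > 0" using x(1) k_pos by (simp add: add_nonneg_pos)
    have "X 2 = (x * x + k)\<^sup>2 / (4 * (x ^ 3 - k * x))"
      using x by (simp add: eq_divide_eq power2_eq_square)
    then have "t 2 = 4 * (x ^ 3 - k * x) / (x * x + k)\<^sup>2"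
      by (simp add: t_eq inverse_eq_divide)
    moreover have "2 * (t 1 + t 1) * (1 - k * t 1 * t 1) = 4 * (x ^ 3 - k * x) / (x * x)\<^sup>2"
      using x(1) unfolding d'[unfolded True] t(2) x_def[symmetric]
      by (simp add: field_simps power2_eq_square power3_eq_cube)
    moreover have "(1 + k * t 1 * t 1)\<^sup>2 = (x * x + k)\<^sup>2 / (x * x)\<^sup>2"
      unfolding d[unfolded True] x_def[symmetric] by (simp add: power_divide)
    moreover have "1 + k * t 1 * t 1 \<noteq> 0"
      using x x2 unfolding d[unfolded True] x_def[symmetric] by simp
    ultimately show ?thesis using True x2 by (simp add: inverse_x_def[of _ _ 0] numeral_2_eq_2)
  next
    case False
    then have n2: "2 \<le> n" using n by simp
    define x c a b where v: "x = X 1" "c = X n" "a = X (n - 1)" "b = X (n + 1)"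
    have nz: "x \<noteq> 0" "c \<noteq> 0" "a \<noteq> 0" "b \<noteq> 0" "c - x \<noteq> 0"
      using n2 X_nonzero X_step(1)[OF n2] by (auto simp: v)
    have s: "(b + a) * (c - x)\<^sup>2 = 2 * (c + x) * (c * x - k)"
      and p: "b * a * (c - x)\<^sup>2 = (c * x + k)\<^sup>2"
      using X_step[OF n2] by (simp_all add: v)
    have tt: "t (n + 1) = inverse b" "t (n - 1) = inverse a" "t n = inverse c" "t 1 = inverse x"
      using n2 by (auto simp: t_eq v)
    have D: "1 + k * t n * t 1 = (c * x + k) / (c * x)" "1 - k * t n * t 1 = (c * x - k) / (c * x)"
      using d d' by (simp_all add: v)
    have ck: "c * x + k \<noteq> 0" using p nz by auto
    have "inverse b * inverse a = (c - x)\<^sup>2 / (c * x + k)\<^sup>2"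
      using p ck nz by (simp add: field_simps)
    then have q: "inverse b * inverse a * (c * x + k)\<^sup>2 = (c - x)\<^sup>2"
      using ck by simp
    have "(inverse b + inverse a) * (c * x + k)\<^sup>2 = (b + a) * (inverse b * inverse a * (c * x + k)\<^sup>2)"
      using nz by (simp add: field_simps)
    then have r: "(inverse b + inverse a) * (c * x + k)\<^sup>2 = 2 * (c + x) * (c * x - k)"
      unfolding q s .
    have "(inverse b + inverse a) * ((c * x + k) / (c * x))\<^sup>2 = 2 * (inverse c + inverse x) * ((c * x - k) / (c * x))"
    proof -
      have "(inverse b + inverse a) * ((c * x + k) / (c * x))\<^sup>2 = 2 * (c + x) * (c * x - k) / (c * x)\<^sup>2"
        unfolding r[symmetric] by (simp add: power_divide)
      also have "\<dots> = 2 * (inverse c + inverse x) * ((c * x - k) / (c * x))"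
        using nz by (simp add: field_simps power2_eq_square)
      finally show ?thesis .
    qed
    moreover have "inverse b * inverse a * ((c * x + k) / (c * x))\<^sup>2 = (inverse c - inverse x)\<^sup>2"
    proof -
      have "inverse b * inverse a * ((c * x + k) / (c * x))\<^sup>2 = (c - x)\<^sup>2 / (c * x)\<^sup>2"
        unfolding q[symmetric] by (simp add: power_divide)
      also have "\<dots> = (inverse c - inverse x)\<^sup>2"
        using nz by (simp add: field_simps power2_eq_square)
      finally show ?thesis .
    qed
    ultimately show ?thesis unfolding D unfolding tt using ck nz by simp
  qed
  then show "1 + k * t n * t 1 \<noteq> 0"
    "(t (n + 1) + t (n - 1)) * (1 + k * t n * t 1)\<^sup>2 = 2 * (t n + t 1) * (1 - k * t n * t 1)"
    "t (n + 1) * t (n - 1) * (1 + k * t n * t 1)\<^sup>2 = (t n - t 1)\<^sup>2"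
    by auto
qed

end

section \<open>Divisibility of the denominators\<close>

text \<open>Membership in \<open>p\<^sup>j\<close> times the localization of the integers at \<open>p\<close>.\<close>

definition divisible_at :: "int \<Rightarrow> nat \<Rightarrow> rat \<Rightarrow> bool" where
  "divisible_at p j r \<longleftrightarrow> (\<exists>a d. \<not> p dvd d \<and> r = of_int (p ^ j * a) / of_int d)"

lemma divisible_atI: "\<not> p dvd d \<Longrightarrow> r = of_int (p ^ j * a) / of_int d \<Longrightarrow> divisible_at p j r"
  unfolding divisible_at_def by blast

context
  fixes p :: int
  assumes p: "prime p"
begin

lemma divisible_at_add:
  assumes "divisible_at p j r" "divisible_at p j s"
  shows "divisible_at p j (r + s)"
proof -
  obtain a d b e where ab: "\<not> p dvd d" "r = of_int (p ^ j * a) / of_int d" "\<not> p dvd e" "s = of_int (p ^ j * b) / of_int e"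
    using assms unfolding divisible_at_def by blast
  have de: "d \<noteq> 0" "e \<noteq> 0" using ab by auto
  show ?thesis
  proof (rule divisible_atI)
    show "\<not> p dvd d * e" using ab p by (simp add: prime_dvd_mult_iff)
    show "r + s = of_int (p ^ j * (a * e + b * d)) / of_int (d * e)"
      using de unfolding ab by (simp add: field_simps)
  qed
qed

lemma divisible_at_mult:
  assumes "divisible_at p i r" "divisible_at p j s"
  shows "divisible_at p (i + j) (r * s)"
proof -
  obtain a d b e where ab: "\<not> p dvd d" "r = of_int (p ^ i * a) / of_int d" "\<not> p dvd e" "s = of_int (p ^ j * b) / of_int e"
    using assms unfolding divisible_at_def by blast
  show ?thesis
  proof (rule divisible_atI)
    show "\<not> p dvd d * e" using ab p by (simp add: prime_dvd_mult_iff)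
    show "r * s = of_int (p ^ (i + j) * (a * b)) / of_int (d * e)"
      unfolding ab by (simp add: power_add mult_ac)
  qed
qed

lemma divisible_at_mono:
  assumes "divisible_at p j r" "i \<le> j"
  shows "divisible_at p i r"
proof -
  obtain a d where ab: "\<not> p dvd d" "r = of_int (p ^ j * a) / of_int d"
    using assms unfolding divisible_at_def by blast
  show ?thesis
  proof (rule divisible_atI[OF ab(1)])
    show "r = of_int (p ^ i * (p ^ (j - i) * a)) / of_int d"
      using assms(2) unfolding ab by (simp add: mult.assoc[symmetric] power_add[symmetric] flip: of_int_power)
  qed
qed

lemma divisible_at_of_int: "divisible_at p 0 (of_int a)"
  using p by (intro divisible_atI[of _ 1 _ _ a]) auto

lemma divisible_at_zero: "divisible_at p j 0"
  using p by (intro divisible_atI[of _ 1 _ _ 0]) auto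

lemma divisible_at_int_mult: "divisible_at p j r \<Longrightarrow> divisible_at p j (of_int a * r)"
  using divisible_at_mult[OF divisible_at_of_int, of j r a] by simp

lemma divisible_at_inverse:
  assumes "divisible_at p 1 r"
  shows "divisible_at p 0 (1 / (1 + r))"
proof -
  obtain a d where ab: "\<not> p dvd d" "r = of_int (p ^ 1 * a) / of_int d"
    using assms unfolding divisible_at_def by blast
  have d: "d \<noteq> 0" using ab by auto
  show ?thesis
  proof (rule divisible_atI)
    show "\<not> p dvd d + p * a" using ab by (simp add: dvd_add_left_iff)
    then have "d + p * a \<noteq> 0" by auto
    then have "of_int d + of_int p * of_int a \<noteq> (0 :: rat)"
      by (metis of_int_add of_int_eq_0_iff of_int_mult)
    then show "1 / (1 + r) = of_int (p ^ 0 * d) / of_int (d + p * a)"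
      using d unfolding ab by (simp add: field_simps)
  qed
qed

lemma divisible_at_fraction_iff:
  assumes "\<not> p dvd a"
  shows "divisible_at p j (of_int b / of_int a) \<longleftrightarrow> p ^ j dvd b"
proof
  assume "p ^ j dvd b"
  then show "divisible_at p j (of_int b / of_int a)"
    using assms unfolding divisible_at_def by blast
next
  assume "divisible_at p j (of_int b / of_int a)"
  then obtain c d where ab: "\<not> p dvd d" "of_int b / of_int a = (of_int (p ^ j * c) / of_int d :: rat)"
    unfolding divisible_at_def by blast
  have "a \<noteq> 0" "d \<noteq> 0" using assms ab by auto
  then have "of_int (b * d) = (of_int (p ^ j * c * a) :: rat)"
    using ab(2) by (simp add: field_simps)
  then have "b * d = p ^ j * c * a" by (simp only: of_int_eq_iff)
  then have "p ^ j dvd b * d" by simp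
  moreover have "coprime (p ^ j) d" using ab p by (simp add: prime_imp_coprime)
  ultimately show "p ^ j dvd b" by (simp add: coprime_dvd_mult_left_iff)
qed

end

lemma square_int_if_square_rat:
  assumes "of_int n = (r :: rat)\<^sup>2"
  shows "\<exists>m. n = m\<^sup>2"
proof -
  obtain a b where r: "quotient_of r = (a, b)" by (cases "quotient_of r")
  have ab: "r = of_int a / of_int b" "coprime a b" "b > 0"
    using r quotient_of_div quotient_of_coprime quotient_of_denom_pos by blast+
  have "of_int (n * b\<^sup>2) = (of_int (a\<^sup>2) :: rat)"
    using ab assms by (simp add: power_divide)
  then have e: "n * b\<^sup>2 = a\<^sup>2" by (simp only: of_int_eq_iff)
  have "b\<^sup>2 dvd a\<^sup>2" unfolding e[symmetric] by simp
  then have "is_unit b" using ab(2) by (metis coprime_common_divisor dvd_refl pow_divides_pow_iff zero_less_numeral)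
  then have "b = 1" using ab by auto
  then show ?thesis using e by auto
qed

section \<open>Numerators, denominators and the rank of apparition\<close>

context congruent_point
begin

text \<open>With \<open>B 0 = 0\<close>, the value 1 at index 0 makes \<open>t n = B n / A n\<close>
  hold there too, so the integer relations below include the case \<open>m = n\<close>.\<close>

definition A :: "nat \<Rightarrow> int" where
  "A n = (if n = 0 then 1 else fst (quotient_of (X n)))"

definition B :: "nat \<Rightarrow> int" where "B = ell_div_seq E P"

lemma B_eq: "0 < n \<Longrightarrow> B n = snd (quotient_of (X n))"
  using multiple_affine[of n] unfolding B_def ell_div_seq_def X_def Q_def
  by (cases "point_mult E n P") auto

lemma B_0: "B 0 = 0" and A_0: "A 0 = 1"
  by (simp_all add: B_def ell_div_seq_def A_def)

lemma B_pos: "0 < n \<Longrightarrow> 0 < B n"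
  by (simp add: B_eq quotient_of_denom_pos')

lemma quotient_X: "0 < n \<Longrightarrow> quotient_of (X n) = (A n, B n)"
  by (simp add: A_def B_eq)

lemma coprime_A_B: "coprime (A n) (B n)"
  by (cases "n = 0") (simp add: A_0 B_0, metis quotient_X quotient_of_coprime neq0_conv)

lemma X_eq: "0 < n \<Longrightarrow> X n = of_int (A n) / of_int (B n)"
  using quotient_X quotient_of_div by blast

lemma A_nonzero: "A n \<noteq> 0"
  using X_eq[of n] X_nonzero[of n] by (cases "n = 0") (auto simp: A_0)

lemma t_fraction: "t n = of_int (B n) / of_int (A n)"
  by (cases "n = 0") (simp_all add: B_0 t_0 t_eq X_eq)

lemma
  assumes "n \<le> m"
  shows denominator_nonzero: "A m * A n + T\<^sup>2 * B m * B n \<noteq> 0"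
    and int_sum: "(B (m + n) * A (m - n) + B (m - n) * A (m + n)) * (A m * A n + T\<^sup>2 * B m * B n)\<^sup>2
      = 2 * (B m * A n + B n * A m) * (A m * A n - T\<^sup>2 * B m * B n) * (A (m + n) * A (m - n))"
    and int_product: "B (m + n) * B (m - n) * (A m * A n + T\<^sup>2 * B m * B n)\<^sup>2
      = (B m * A n - B n * A m)\<^sup>2 * (A (m + n) * A (m - n))"
proof -
  define a b c d a1 b1 a2 b2 s :: rat where v: "a = of_int (A m)" "b = of_int (B m)" "c = of_int (A n)" "d = of_int (B n)"
    "a1 = of_int (A (m + n))" "b1 = of_int (B (m + n))" "a2 = of_int (A (m - n))" "b2 = of_int (B (m - n))" "s = of_int T"
  have nz: "a \<noteq> 0" "c \<noteq> 0" "a1 \<noteq> 0" "a2 \<noteq> 0" by (simp_all add: v A_nonzero)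
  have t: "t m = b / a" "t n = d / c" "t (m + n) = b1 / a1" "t (m - n) = b2 / a2"
    by (simp_all add: t_fraction v)
  have D: "1 + k * t m * t n = (a * c + s\<^sup>2 * b * d) / (a * c)" "1 - k * t m * t n = (a * c - s\<^sup>2 * b * d) / (a * c)"
    "t m + t n = (b * c + d * a) / (a * c)" "t m - t n = (b * c - d * a) / (a * c)"
    "t (m + n) + t (m - n) = (b1 * a2 + b2 * a1) / (a1 * a2)" "t (m + n) * t (m - n) = (b1 * b2) / (a1 * a2)"
    unfolding t k_def v(9)[symmetric] using nz by (simp_all add: field_simps)
  have clear_sum: "u * w\<^sup>2 = 2 * p * r * q" if "q \<noteq> 0" "z \<noteq> 0" "u / q * (w / z)\<^sup>2 = 2 * (p / z) * (r / z)"
    for u w p r q z :: rat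
    using that by (simp add: field_simps power2_eq_square)
  have clear_product: "u * w\<^sup>2 = p\<^sup>2 * q" if "q \<noteq> 0" "z \<noteq> 0" "u / q * (w / z)\<^sup>2 = (p / z)\<^sup>2"
    for u w p q z :: rat
    using that by (simp add: field_simps power2_eq_square)
  note add = addition[OF assms, unfolded D]
  have "a * c + s\<^sup>2 * b * d \<noteq> 0" using add by auto
  then show "A m * A n + T\<^sup>2 * B m * B n \<noteq> 0"
    unfolding v by (auto simp flip: of_int_add of_int_mult of_int_power)
  have "(b1 * a2 + b2 * a1) * (a * c + s\<^sup>2 * b * d)\<^sup>2
      = 2 * (b * c + d * a) * (a * c - s\<^sup>2 * b * d) * (a1 * a2)"
    using add nz by (intro clear_sum[of "a1 * a2" "a * c"]) (simp_all add: mult.assoc)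
  then have "of_int ((B (m + n) * A (m - n) + B (m - n) * A (m + n)) * (A m * A n + T\<^sup>2 * B m * B n)\<^sup>2)
      = (of_int (2 * (B m * A n + B n * A m) * (A m * A n - T\<^sup>2 * B m * B n) * (A (m + n) * A (m - n))) :: rat)"
    unfolding v of_int_mult of_int_add of_int_diff of_int_power of_int_numeral .
  then show "(B (m + n) * A (m - n) + B (m - n) * A (m + n)) * (A m * A n + T\<^sup>2 * B m * B n)\<^sup>2
      = 2 * (B m * A n + B n * A m) * (A m * A n - T\<^sup>2 * B m * B n) * (A (m + n) * A (m - n))"
    unfolding of_int_eq_iff .
  have "b1 * b2 * (a * c + s\<^sup>2 * b * d)\<^sup>2 = (b * c - d * a)\<^sup>2 * (a1 * a2)"
    using add nz by (intro clear_product[of "a1 * a2" "a * c"]) (simp_all add: mult.assoc)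
  then have "of_int (B (m + n) * B (m - n) * (A m * A n + T\<^sup>2 * B m * B n)\<^sup>2)
      = (of_int ((B m * A n - B n * A m)\<^sup>2 * (A (m + n) * A (m - n))) :: rat)"
    unfolding v of_int_mult of_int_add of_int_diff of_int_power .
  then show "B (m + n) * B (m - n) * (A m * A n + T\<^sup>2 * B m * B n)\<^sup>2
      = (B m * A n - B n * A m)\<^sup>2 * (A (m + n) * A (m - n))"
    unfolding of_int_eq_iff .
qed

lemma prime_not_dvd_A: "prime p \<Longrightarrow> p dvd B n \<Longrightarrow> \<not> p dvd A n"
  using coprime_A_B[of n] by (meson coprime_common_divisor not_prime_unit)

text \<open>The multiples reducing to infinity modulo \<open>p\<close> behave like a subgroup. Since
  \<open>w\<close> is prime to \<open>p\<close>, the product relation gives one of the two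
  divisibilities, and the sum relation passes from it to the other.\<close>

lemma prime_dvd_B_add_diff:
  assumes p: "prime p" "p dvd B m" "p dvd B n" and "n \<le> m"
  shows "p dvd B (m + n) \<and> p dvd B (m - n)"
proof -
  define w where "w = A m * A n + T\<^sup>2 * B m * B n"
  have w: "\<not> p dvd w"
    using p prime_not_dvd_A[of p m] prime_not_dvd_A[of p n] unfolding w_def
    by (simp add: dvd_add_left_iff prime_dvd_mult_iff)
  have "p dvd B (m + n) * B (m - n) * w\<^sup>2"
    unfolding w_def int_product[OF assms(4)] using p by (simp add: power2_eq_square)
  then have 1: "p dvd B (m + n) \<or> p dvd B (m - n)"
    using w p by (auto simp: prime_dvd_mult_iff prime_dvd_power_iff)
  have "p dvd (B (m + n) * A (m - n) + B (m - n) * A (m + n)) * w\<^sup>2"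
    unfolding w_def int_sum[OF assms(4)] using p by simp
  then have 2: "p dvd B (m + n) * A (m - n) + B (m - n) * A (m + n)"
    using w p by (auto simp: prime_dvd_mult_iff prime_dvd_power_iff)
  show ?thesis using 1
  proof
    assume a: "p dvd B (m + n)"
    then have "p dvd B (m - n) * A (m + n)" using 2 by (simp add: dvd_add_right_iff)
    then show ?thesis using prime_not_dvd_A[OF p(1) a] a p by (simp add: prime_dvd_mult_iff)
  next
    assume a: "p dvd B (m - n)"
    then have "p dvd B (m + n) * A (m - n)" using 2 by (simp add: dvd_add_left_iff)
    then show ?thesis using prime_not_dvd_A[OF p(1) a] a p by (simp add: prime_dvd_mult_iff)
  qed
qed

lemma prime_dvd_B_multiple:
  assumes "prime p" "p dvd B r"
  shows "p dvd B (j * r)"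
proof (induction j)
  case 0
  then show ?case by (simp add: B_0)
next
  case (Suc j)
  show ?case
  proof (cases "j = 0")
    case False
    then have "r \<le> j * r" by simp
    then show ?thesis using prime_dvd_B_add_diff[of p "j * r" r] Suc assms by (simp add: add.commute)
  qed (use assms in simp)
qed

text \<open>Subtracting \<open>r\<close> repeatedly keeps the denominator divisible by
  \<open>p\<close>; the index below \<open>r\<close> that remains must be 0 by minimality.\<close>

lemma rank_of_apparition:
  assumes p: "prime p" "p dvd B r" "0 < r" and least: "\<And>m. 0 < m \<Longrightarrow> m < r \<Longrightarrow> \<not> p dvd B m"
    and "p dvd B n"
  shows "r dvd n"
  using assms(5)
proof (induction n rule: less_induct)
  case (less n)
  show ?case
  proof (cases "n < r")
    case True
    then show ?thesis using least[of n] less.prems by (cases "n = 0") auto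
  next
    case False
    then have "p dvd B (n - r)" using prime_dvd_B_add_diff[of p n r] p less.prems by simp
    then have "r dvd n - r" using less.IH[of "n - r"] False p by simp
    then have "r dvd (n - r) + r" by (rule dvd_add) simp
    then show ?thesis using False by simp
  qed
qed

lemma A_B_square:
  assumes "0 < n"
  shows "\<exists>c. c\<^sup>2 = A n * ((A n)\<^sup>2 - T\<^sup>2 * (B n)\<^sup>2) * B n"
proof -
  obtain y where y: "y\<^sup>2 = X n ^ 3 - k * X n" using multiple_cases assms by blast
  define a b where v: "a = (of_int (A n) :: rat)" "b = (of_int (B n) :: rat)"
  have b: "b \<noteq> 0" using B_pos[OF assms] by (simp add: v)
  have "(y * b\<^sup>2)\<^sup>2 = (X n ^ 3 - k * X n) * b ^ 4" unfolding power_mult_distrib y by simp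
  also have "\<dots> = a * (a\<^sup>2 - k * b\<^sup>2) * b"
    using b unfolding X_eq[OF assms] v[symmetric] by (simp add: field_simps power2_eq_square power3_eq_cube power4_eq_xxxx)
  finally have "of_int (A n * ((A n)\<^sup>2 - T\<^sup>2 * (B n)\<^sup>2) * B n) = (y * b\<^sup>2)\<^sup>2"
    by (simp add: v k_def)
  then show ?thesis using square_int_if_square_rat by metis
qed

text \<open>In the square of \<open>A_B_square\<close> the cofactor of \<open>B n\<close> is prime
  to \<open>p\<close>. The exponent 2 makes the congruence for multiples precise enough even when
  \<open>p = q = 2\<close>.\<close>

lemma square_prime_dvd_B:
  assumes "prime p" "p dvd B n"
  shows "p\<^sup>2 dvd B n"
proof (cases "n = 0")
  case False
  then obtain c where c: "c\<^sup>2 = A n * ((A n)\<^sup>2 - T\<^sup>2 * (B n)\<^sup>2) * B n" using A_B_square by auto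
  then have "p dvd c" using assms by (metis dvd_mult prime_dvd_power)
  then have "p\<^sup>2 dvd A n * ((A n)\<^sup>2 - T\<^sup>2 * (B n)\<^sup>2) * B n" unfolding c[symmetric] by simp
  moreover have "\<not> p dvd A n * ((A n)\<^sup>2 - T\<^sup>2 * (B n)\<^sup>2)"
    using assms prime_not_dvd_A[OF assms] by (simp add: prime_dvd_mult_iff dvd_diff_left_iff prime_dvd_power_iff)
  then have "coprime (p\<^sup>2) (A n * ((A n)\<^sup>2 - T\<^sup>2 * (B n)\<^sup>2))" using prime_imp_coprime[OF assms(1)] coprime_power_left_iff by blast
  ultimately show ?thesis by (simp add: coprime_dvd_mult_right_iff)
qed (simp add: B_0)

text \<open>To leading order \<open>t\<close> is the square of a parameter of the formal group at
  infinity, so multiplication by \<open>j\<close> scales it by the square of \<open>j\<close>.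
  Modulo \<open>p ^ (3 * e)\<close> the sum relation is the linear recurrence that the squares
  satisfy.\<close>

lemma t_multiple_congruence:
  assumes p: "prime p" and e: "divisible_at p e (t M)" "1 \<le> e"
  shows "divisible_at p (3 * e) (t (j * M) - of_int (int j ^ 2) * t M)"
proof (induction j rule: induct_nat_012)
  case 0
  then show ?case using p by (simp add: t_0 divisible_at_zero)
next
  case 1
  then show ?case using p by (simp add: divisible_at_zero)
next
  case (ge2 j)
  define a b where v: "a = t (Suc j * M)" "b = t M"
  have le: "M \<le> Suc j * M" by simp
  have b: "divisible_at p e b" using e v by simp
  have "divisible_at p e (a - of_int (int (Suc j) ^ 2) * b)"
    using divisible_at_mono[OF p ge2.IH(2), of e] v by simp
  from divisible_at_add[OF p this divisible_at_int_mult[OF p b, of "int (Suc j) ^ 2"]]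
  have a: "divisible_at p e a" by simp
  have k: "k = of_int (T\<^sup>2)" by (simp add: k_def)
  define r where "r = k * (a * b)"
  have ab: "divisible_at p (e + e) (a * b)" using divisible_at_mult[OF p a b] .
  have r: "divisible_at p (e + e) r" unfolding r_def k by (rule divisible_at_int_mult[OF p ab])
  have u: "divisible_at p 0 (1 / (1 + r))"
    by (rule divisible_at_inverse[OF p divisible_at_mono[OF p r]]) (use e in simp)
  have nz: "1 + r \<noteq> 0" using addition[OF le] by (simp add: r_def v mult.assoc)
  \<comment> \<open>Comes from \<open>1 - r = (1 + r)\<^sup>2 - (3 + r) * r\<close>: the quotient
    \<open>(1 - r) / (1 + r)\<^sup>2\<close> is 1 up to a multiple of \<open>r\<close>, which has
    order \<open>2 * e\<close>, and \<open>a + b\<close> has order \<open>e\<close>.\<close>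
  define err where "err = (a + b) * (of_int (-2) * ((of_int 3 + r) * r)) * (1 / (1 + r) * (1 / (1 + r)))"
  have r0: "divisible_at p 0 (of_int 3 + r)"
    using divisible_at_add[OF p divisible_at_of_int[OF p, of 3] divisible_at_mono[OF p r, of 0]] by simp
  have "divisible_at p (e + (0 + (e + e)) + (0 + 0)) err"
    unfolding err_def
    by (intro divisible_at_mult[OF p] divisible_at_int_mult[OF p] divisible_at_add[OF p] a b r r0 u)
  moreover have "e + (0 + (e + e)) + (0 + 0) = 3 * e" by simp
  ultimately have err: "divisible_at p (3 * e) err" by metis
  have idx: "Suc j * M + M = Suc (Suc j) * M" "Suc j * M - M = j * M" by simp_all
  have "(t (Suc (Suc j) * M) + t (j * M)) * (1 + r)\<^sup>2 = 2 * (a + b) * (1 - r)"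
    using addition[OF le] by (simp only: idx r_def v mult.assoc)
  then have "t (Suc (Suc j) * M) + t (j * M) = 2 * (a + b) * (1 - r) / (1 + r)\<^sup>2"
    using nz by (simp add: field_simps)
  also have "\<dots> = 2 * (a + b) + err"
  proof -
    define i where "i = 1 / (1 + r)"
    have i: "i * (1 + r) = 1" using nz by (simp add: i_def)
    have "err = (a + b) * (- 2 * ((3 + r) * r)) * (i * i)" by (simp add: err_def i_def)
    then have "2 * (a + b) * (1 - r) = (2 * (a + b) + err) * (1 + r)\<^sup>2"
      using i by algebra
    then show ?thesis using nz by (simp add: divide_eq_eq)
  qed
  finally have "t (Suc (Suc j) * M) = 2 * (a + b) + err - t (j * M)" by simp
  then have "t (Suc (Suc j) * M) - of_int (int (Suc (Suc j)) ^ 2) * b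
    = of_int 2 * (a - of_int (int (Suc j) ^ 2) * b) + of_int (- 1) * (t (j * M) - of_int (int j ^ 2) * b) + err"
    by (simp add: power2_eq_square algebra_simps)
  moreover have "divisible_at p (3 * e) \<dots>"
    using ge2.IH unfolding v by (intro divisible_at_add[OF p] divisible_at_int_mult[OF p] err)
  ultimately show ?case by (simp add: v)
qed

text \<open>The congruence for \<open>t (q * M)\<close> holds modulo \<open>p ^ (3 * e)\<close>,
  while the multiplicity \<open>s\<close> is at most \<open>e + 2\<close>, which is less than
  \<open>3 * e\<close> as \<open>e >= 2\<close>. Hence \<open>p ^ (s + 1)\<close> dividing
  \<open>B (q * M)\<close> would also divide \<open>(int q)\<^sup>2 * B M\<close>.\<close>

lemma multiplicity_B_prime_multiple:
  assumes p: "prime p" "p dvd B M" and q: "prime q" and M: "0 < M"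
  shows "multiplicity p (B (q * M)) \<le> multiplicity p ((int q)\<^sup>2 * B M)"
proof -
  define e where "e = multiplicity p (B M)"
  define s where "s = multiplicity p ((int q)\<^sup>2 * B M)"
  have BM: "B M \<noteq> 0" using B_pos[OF M] by simp
  have q0: "int q \<noteq> 0" using q by (simp add: prime_gt_0_nat)
  have pe: "prime_elem p" using p(1) by (rule prime_imp_prime_elem)
  have nu: "\<not> is_unit p" using p not_prime_unit by blast
  have e2: "2 \<le> e" unfolding e_def
    by (rule multiplicity_geI[OF BM nu square_prime_dvd_B[OF p]])
  have "multiplicity p (int q) \<le> 1"
  proof (cases "p = int q")
    case True
    have "p \<noteq> 0" using p by auto
    then show ?thesis unfolding True[symmetric] using nu by (simp add: multiplicity_self)
  next
    case False
    then show ?thesis using prime_multiplicity_other[OF p(1), of "int q"] q by simp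
  qed
  then have s: "s \<le> e + 2"
    unfolding s_def e_def using pe BM q0 by (simp add: prime_elem_multiplicity_mult_distrib prime_elem_multiplicity_power_distrib)
  have nA: "\<not> p dvd A M" "\<not> p dvd A (q * M)"
    using prime_not_dvd_A[OF p] prime_not_dvd_A[OF p(1) prime_dvd_B_multiple[OF p]] by auto
  have "divisible_at p e (t M)"
    unfolding t_fraction divisible_at_fraction_iff[OF p(1) nA(1)] e_def by (rule multiplicity_dvd)
  from t_multiple_congruence[OF p(1) this, of q] e2
  have c: "divisible_at p (3 * e) (t (q * M) - of_int (int q ^ 2) * t M)" by simp
  have BqM: "B (q * M) \<noteq> 0" using B_pos[of "q * M"] M q by (simp add: prime_gt_0_nat)
  show ?thesis
  proof (rule ccontr)
    assume "\<not> ?thesis"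
    then have "p ^ (s + 1) dvd B (q * M)" unfolding s_def by (intro multiplicity_dvd') simp
    then have "divisible_at p (s + 1) (t (q * M))"
      unfolding t_fraction divisible_at_fraction_iff[OF p(1) nA(2)] .
    moreover have "divisible_at p (s + 1) (of_int (- 1) * (t (q * M) - of_int (int q ^ 2) * t M))"
      by (intro divisible_at_int_mult[OF p(1)] divisible_at_mono[OF p(1) c]) (use s e2 in simp)
    ultimately have "divisible_at p (s + 1) (t (q * M) + of_int (- 1) * (t (q * M) - of_int (int q ^ 2) * t M))"
      by (rule divisible_at_add[OF p(1)])
    also have "t (q * M) + of_int (- 1) * (t (q * M) - of_int (int q ^ 2) * t M) = of_int ((int q)\<^sup>2 * B M) / of_int (A M)"
      by (simp add: t_fraction[of M])
    finally have "p ^ (s + 1) dvd (int q)\<^sup>2 * B M"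
      using divisible_at_fraction_iff[OF p(1) nA(1)] by blast
    then have "s + 1 \<le> s" unfolding s_def
      using BM q0 nu by (subst (asm) power_dvd_iff_le_multiplicity) auto
    then show False by simp
  qed
qed

text \<open>Compared prime by prime: a prime \<open>p\<close> dividing \<open>B n\<close> is not
  primitive, so its rank of apparition is a proper divisor of \<open>n\<close> and divides
  \<open>n div q\<close> for some prime \<open>q\<close>. The factor for this \<open>q\<close> alone
  already has enough powers of \<open>p\<close>.\<close>

lemma B_dvd_prod_if_no_primitive_divisor:
  assumes n: "0 < n" and np: "\<not> (\<exists>p. primitive_divisor B n p)"
  shows "B n dvd (\<Prod>q\<in>prime_factors n. (int q)\<^sup>2 * B (n div q))"
proof (rule multiplicity_le_imp_dvd)
  show "B n \<noteq> 0" using B_pos[OF n] by simp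
  fix p :: int assume p: "prime p"
  have nu: "\<not> is_unit p" using p not_prime_unit by blast
  have nz: "(int q)\<^sup>2 * B (n div q) \<noteq> 0" if "q \<in> prime_factors n" for q
  proof -
    have "prime q" "q dvd n" using that by auto
    then have "0 < n div q" using n by (auto elim: dvdE)
    then show ?thesis using B_pos[of "n div q"] \<open>prime q\<close> by (auto simp: prime_gt_0_nat)
  qed
  then have nz': "(\<Prod>q\<in>prime_factors n. (int q)\<^sup>2 * B (n div q)) \<noteq> 0" by simp
  show "multiplicity p (B n) \<le> multiplicity p (\<Prod>q\<in>prime_factors n. (int q)\<^sup>2 * B (n div q))"
  proof (cases "p dvd B n")
    case False
    then show ?thesis by (simp add: not_dvd_imp_multiplicity_0)
  next
    case True
    then obtain m where m: "0 < m" "m < n" "p dvd B m"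
      using np p unfolding primitive_divisor_def by (metis One_nat_def Suc_leI less_le_trans zero_less_one)
    define r where "r = (LEAST m. 0 < m \<and> p dvd B m)"
    have r: "0 < r" "p dvd B r" unfolding r_def using m LeastI[of "\<lambda>m. 0 < m \<and> p dvd B m" m] by auto
    have least: "\<not> p dvd B i" if "0 < i" "i < r" for i
      using not_less_Least[of i "\<lambda>m. 0 < m \<and> p dvd B m"] that unfolding r_def by blast
    have "r \<le> m" using least[of m] m by force
    have "r dvd n" using rank_of_apparition[OF p r(2,1) least True] .
    then obtain j where j: "n = r * j" by blast
    have "j \<noteq> 1" using \<open>r \<le> m\<close> m j by auto
    then obtain q where q: "prime q" "q dvd j" using prime_factor_nat by blast
    then obtain i where i: "j = q * i" by blast
    define M where "M = n div q"
    have M: "n = q * M" "M = i * r" unfolding M_def j i using q by (auto simp: prime_gt_0_nat)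
    have pM: "p dvd B M" unfolding M(2) by (rule prime_dvd_B_multiple[OF p r(2)])
    have "0 < M" using M n by (cases M) auto
    from multiplicity_B_prime_multiple[OF p pM q(1) this]
    have "multiplicity p (B n) \<le> multiplicity p ((int q)\<^sup>2 * B (n div q))"
      unfolding M_def[symmetric] M(1)[symmetric] .
    also have "q \<in> prime_factors n" using q M n by (auto simp: in_prime_factors_iff)
    then have "multiplicity p ((int q)\<^sup>2 * B (n div q)) \<le> multiplicity p (\<Prod>q\<in>prime_factors n. (int q)\<^sup>2 * B (n div q))"
      using nz' by (intro dvd_imp_multiplicity_le dvd_prodI) auto
    finally show ?thesis .
  qed
qed

end

section \<open>Growth of the numerators at even multiples\<close>

lemma coprime_fraction_unique:
  fixes a b c d :: int
  assumes "coprime a b" "coprime c d" "b > 0" "d > 0" "a * d = c * b"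
  shows "a = c \<and> b = d"
proof -
  have "b dvd a * d" "d dvd c * b" using assms(5) by (metis dvd_triv_right)+
  then have "b dvd d" "d dvd b"
    using assms by (auto simp: coprime_dvd_mult_right_iff coprime_commute)
  then have "b = d" using assms(3,4) by (simp add: zdvd_antisym_nonneg)
  then show ?thesis using assms by simp
qed

lemma square_fraction:
  fixes a b :: int
  assumes "coprime a b" "b > 0" "of_int a / of_int b = (r :: rat)\<^sup>2"
  shows "\<exists>u v. a = u\<^sup>2 \<and> b = v\<^sup>2 \<and> v > 0"
proof -
  obtain u v where r: "quotient_of r = (u, v)" by (cases "quotient_of r")
  have uv: "r = of_int u / of_int v" "coprime u v" "v > 0"
    using r quotient_of_div quotient_of_coprime quotient_of_denom_pos by blast+
  have "of_int (a * v\<^sup>2) = (of_int (u\<^sup>2 * b) :: rat)"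
    using uv(3) assms(2,3) unfolding uv(1) by (simp add: field_simps)
  then have "a * v\<^sup>2 = u\<^sup>2 * b" by (simp only: of_int_eq_iff)
  with assms uv have "a = u\<^sup>2 \<and> b = v\<^sup>2"
    by (intro coprime_fraction_unique) auto
  then show ?thesis using uv by blast
qed

text \<open>By Bezout \<open>n\<close> is a combination of \<open>n * a\<close>,
  \<open>n * b\<close> and \<open>n * c\<close>. It serves to compare two proportional integer
  triples, one of them primitive.\<close>

lemma dvd_if_dvd_mult_coprime_triple:
  fixes a b c n :: int
  assumes "\<And>p. prime p \<Longrightarrow> p dvd a \<Longrightarrow> p dvd b \<Longrightarrow> p dvd c \<Longrightarrow> False"
    and "d dvd n * a" "d dvd n * b" "d dvd n * c" and "a \<noteq> 0"
  shows "d dvd n"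
proof -
  have "gcd a (gcd b c) = 1"
  proof (rule ccontr)
    assume "gcd a (gcd b c) \<noteq> 1"
    moreover have "gcd a (gcd b c) \<noteq> 0" using assms(5) by simp
    ultimately obtain p where "prime p" "p dvd gcd a (gcd b c)"
      by (metis gcd_int_int_eq gcd_pos_int is_unit_gcd prime_divisorE is_unit_gcd_iff)
    then show False using assms(1)[of p] by auto
  qed
  moreover obtain x y where "x * a + y * gcd b c = gcd a (gcd b c)" using bezout_int by blast
  moreover obtain z w where "z * b + w * c = gcd b c" using bezout_int by blast
  ultimately have "x * a + y * (z * b + w * c) = 1" by simp
  then have "n = x * (n * a) + y * (z * (n * b) + w * (n * c))" by algebra
  also have "d dvd \<dots>" by (meson assms(2-4) dvd_add dvd_mult)
  finally show ?thesis .
qed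

lemma odd_square_mod_8:
  assumes "odd (x :: int)"
  shows "x\<^sup>2 mod 8 = 1"
proof -
  obtain y where y: "x = 2 * y + 1" using assms by (elim oddE)
  have "even (y * (y + 1))" by simp
  then obtain z where z: "y * (y + 1) = 2 * z" by blast
  have "x\<^sup>2 = 4 * (y * (y + 1)) + 1" unfolding y by algebra
  also have "\<dots> = 1 + z * 8" unfolding z by simp
  finally show ?thesis by simp
qed

lemma square_mod_8: "(x :: int)\<^sup>2 mod 8 \<in> {0, 1, 4}"
proof (cases "even x")
  case True
  then obtain y where y: "x = 2 * y" by blast
  have "x\<^sup>2 mod 8 = (4 * y\<^sup>2) mod (4 * 2)" by (simp add: y power_mult_distrib)
  also have "\<dots> = 4 * (y\<^sup>2 mod 2)" by (rule mult_mod_right[symmetric])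
  finally show ?thesis by (cases "even (y\<^sup>2)") (auto simp: even_iff_mod_2_eq_zero odd_iff_mod_2_eq_one)
qed (simp add: odd_square_mod_8)

text \<open>Three squares in arithmetic progression have congruent end terms modulo 8, so 8 divides
  twice the difference \<open>T * v\<^sup>2\<close>. For odd \<open>v\<close> this makes
  \<open>T\<close> divisible by 4.\<close>

lemma even_if_squares_in_progression:
  fixes u v s w T :: int
  assumes "u\<^sup>2 - T * v\<^sup>2 = s\<^sup>2" "u\<^sup>2 + T * v\<^sup>2 = w\<^sup>2" "squarefree T"
  shows "even v"
proof (rule ccontr)
  assume "odd v"
  then have v: "v\<^sup>2 mod 8 = 1" by (rule odd_square_mod_8)
  define j where "j = v\<^sup>2 div 8"
  have j: "v\<^sup>2 = 1 + 8 * j" using v mult_div_mod_eq[of 8 "v\<^sup>2"] unfolding j_def by linarith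
  have "\<not> 2\<^sup>2 dvd T"
  proof
    assume "2\<^sup>2 dvd T"
    then have "is_unit (2 :: int)" using assms(3) squarefreeD by blast
    then show False by simp
  qed
  then have T: "T mod 4 \<noteq> 0" by (simp add: dvd_eq_mod_eq_0)
  have e: "u\<^sup>2 - T - 8 * (T * j) = s\<^sup>2" "u\<^sup>2 + T + 8 * (T * j) = w\<^sup>2"
    using assms(1,2) unfolding j by (simp_all add: algebra_simps)
  have impossible: False if "U - T - 8 * J = S" "U + T + 8 * J = W" "U mod 8 \<in> {0, 1, 4}" "S mod 8 \<in> {0, 1, 4}"
    "W mod 8 \<in> {0, 1, 4}" for U S W J :: int
  proof -
    have S: "S = 2 * U - W" using that by simp
    have "(2 * U) mod 8 = (2 * (U mod 8)) mod 8" by (simp add: mod_mult_right_eq)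
    then have "S mod 8 = (2 * (U mod 8) - W mod 8) mod 8" unfolding S by (rule mod_diff_cong) simp
    then have "S mod 8 = W mod 8" using that(3-5) by (elim insertE) simp_all
    then have "8 dvd W - S" by (metis mod_eq_dvd_iff)
    then obtain K where "W - S = 8 * K" by blast
    then have "T = 4 * (K - 2 * J)" using that by simp
    then show False using T by simp
  qed
  show False by (rule impossible[OF e square_mod_8 square_mod_8 square_mod_8])
qed

section \<open>Duplication and the comparison of \<open>A (2 * m)\<close> with
  \<open>B m\<close>\<close>

context congruent_point
begin

lemma X_double:
  assumes "0 < m"
  shows "X (2 * m) * (4 * (X m ^ 3 - k * X m)) = ((X m)\<^sup>2 + k)\<^sup>2" "X m ^ 3 - k * X m \<noteq> 0"
proof -
  define x z where v: "x = X m" "z = X (2 * m)"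
  have nz: "x \<noteq> 0" "z \<noteq> 0" using assms X_nonzero by (auto simp: v)
  have "t (2 * m) * (1 + k * t m * t m)\<^sup>2 = 4 * t m * (1 - k * t m * t m)"
    using addition[of m m, unfolded mult_2[symmetric]] by (simp add: t_0)
  then have "inverse z * (1 + k * inverse x * inverse x)\<^sup>2 = 4 * inverse x * (1 - k * inverse x * inverse x)"
    using assms by (simp add: t_eq v)
  moreover have "1 + k * inverse x * inverse x = (x\<^sup>2 + k) / x\<^sup>2" "1 - k * inverse x * inverse x = (x\<^sup>2 - k) / x\<^sup>2"
    using nz by (simp_all add: field_simps power2_eq_square)
  ultimately have i: "inverse z * ((x\<^sup>2 + k) / x\<^sup>2)\<^sup>2 = 4 * inverse x * ((x\<^sup>2 - k) / x\<^sup>2)" by simp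
  have "(x\<^sup>2 + k)\<^sup>2 = (inverse z * ((x\<^sup>2 + k) / x\<^sup>2)\<^sup>2) * (z * (x\<^sup>2)\<^sup>2)"
    using nz by (simp add: power_divide)
  also have "\<dots> = z * (4 * (inverse x * x\<^sup>2 * (x\<^sup>2 - k)))"
    unfolding i using nz by (simp add: power2_eq_square)
  also have "inverse x * x\<^sup>2 * (x\<^sup>2 - k) = x ^ 3 - k * x"
    using nz by (simp add: power2_eq_square power3_eq_cube algebra_simps)
  finally have e: "z * (4 * (x ^ 3 - k * x)) = (x\<^sup>2 + k)\<^sup>2" by simp
  then show "X (2 * m) * (4 * (X m ^ 3 - k * X m)) = ((X m)\<^sup>2 + k)\<^sup>2"
    by (simp add: v)
  have "x\<^sup>2 + k > 0" using k_pos by (simp add: add_nonneg_pos)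
  then show "X m ^ 3 - k * X m \<noteq> 0" using e by (auto simp: v)
qed

text \<open>The 2-descent map is trivial on doubled points: \<open>x - e\<close> is a square for
  each abscissa \<open>e\<close> of a 2-torsion point, here 0, \<open>T\<close> and
  \<open>-T\<close>. The roots are explicit, with denominator \<open>2 * y\<close>.\<close>

lemma double_squares:
  assumes "0 < m"
  shows "\<exists>r. X (2 * m) = r\<^sup>2" "\<exists>r. X (2 * m) - of_int T = r\<^sup>2" "\<exists>r. X (2 * m) + of_int T = r\<^sup>2"
proof -
  define T' x z :: rat where v: "T' = of_int T" "x = X m" "z = X (2 * m)"
  obtain y where "y\<^sup>2 = X m ^ 3 - k * X m" using multiple_cases assms by blast
  then have y: "y\<^sup>2 = x ^ 3 - k * x" "y \<noteq> 0" using X_double(2)[OF assms] by (auto simp: v)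
  have z: "z * (4 * y\<^sup>2) = (x\<^sup>2 + k)\<^sup>2" using X_double(1)[OF assms] y by (simp add: v)
  have k: "k = T'\<^sup>2" by (simp add: v k_def)
  have root: "a = (c / (2 * y))\<^sup>2" if "a * (4 * y\<^sup>2) = c\<^sup>2" for a c
    using that y(2) by (simp add: power_divide power_mult_distrib eq_divide_eq)
  have "z = ((x\<^sup>2 + k) / (2 * y))\<^sup>2"
    using z by (rule root)
  then show "\<exists>r. X (2 * m) = r\<^sup>2" unfolding v by blast
  have "(z - T') * (4 * y\<^sup>2) = (x\<^sup>2 - 2 * T' * x - k)\<^sup>2"
    using z y(1) k by algebra
  then have "z - T' = ((x\<^sup>2 - 2 * T' * x - k) / (2 * y))\<^sup>2"
    by (rule root)
  then show "\<exists>r. X (2 * m) - of_int T = r\<^sup>2" unfolding v by blast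
  have "(z + T') * (4 * y\<^sup>2) = (x\<^sup>2 + 2 * T' * x - k)\<^sup>2"
    using z y(1) k by algebra
  then have "z + T' = ((x\<^sup>2 + 2 * T' * x - k) / (2 * y))\<^sup>2"
    by (rule root)
  then show "\<exists>r. X (2 * m) + of_int T = r\<^sup>2" unfolding v by blast
qed

text \<open>The indices \<open>j + 1\<close> and \<open>j\<close> have sum \<open>2 * j + 1\<close>
  and difference 1, so the product relation is the claim. It carries the sign and the square class
  of \<open>X 1\<close> to all odd multiples.\<close>

lemma odd_multiple_square:
  "\<exists>r. r \<noteq> 0 \<and> t (2 * j + 1) * t 1 = r\<^sup>2"
proof (cases "j = 0")
  case True
  then show ?thesis using t_nonzero[of 1] by (intro exI[of _ "t 1"]) (simp add: power2_eq_square)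
next
  case False
  define d where "d = 1 + k * t (j + 1) * t j"
  have idx: "j + 1 + j = 2 * j + 1" "j + 1 - j = 1" by simp_all
  have "t (2 * j + 1) * t 1 * d\<^sup>2 = (t (j + 1) - t j)\<^sup>2" "d \<noteq> 0"
    using addition[of j "j + 1", unfolded idx] by (simp_all add: d_def)
  then have "t (2 * j + 1) * t 1 = ((t (j + 1) - t j) / d)\<^sup>2"
    by (simp add: power_divide eq_divide_eq)
  moreover have "t (2 * j + 1) * t 1 \<noteq> 0" using t_nonzero by simp
  ultimately show ?thesis by (metis zero_power2)
qed

lemma odd_multiple_negative:
  assumes "X 1 < 0" "odd n"
  shows "X n < 0"
proof -
  obtain j where j: "n = 2 * j + 1" using assms by (elim oddE)
  obtain r where r: "r \<noteq> 0" "t n * t 1 = r\<^sup>2" using odd_multiple_square j by metis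
  then have "0 < t n * t 1" by simp
  moreover have "t 1 < 0" using assms by (simp add: t_eq)
  ultimately have "t n < 0" by (simp add: zero_less_mult_iff)
  then show ?thesis using j by (simp add: t_eq)
qed

lemma odd_multiple_of_square:
  assumes "X 1 = q\<^sup>2" "odd n"
  shows "\<exists>r. X n = r\<^sup>2"
proof -
  obtain j where j: "n = 2 * j + 1" using assms by (elim oddE)
  obtain r where r: "r \<noteq> 0" "t n * t 1 = r\<^sup>2" using odd_multiple_square j by metis
  have "X n \<noteq> 0" "q \<noteq> 0" using X_nonzero[of n] X_nonzero[of 1] assms(1) j by auto
  have "inverse (X n) * inverse (q\<^sup>2) = r\<^sup>2" using r j by (simp add: t_eq assms(1)[unfolded One_nat_def])
  then have "inverse (X n) = (r * q)\<^sup>2"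
    using \<open>q \<noteq> 0\<close> unfolding power_mult_distrib by (metis mult.assoc left_inverse mult.right_neutral power_not_zero)
  then have "X n = (inverse (r * q))\<^sup>2" by (metis inverse_inverse_eq power_inverse)
  then show ?thesis by blast
qed

text \<open>\<open>G\<close> is the factor cancelling between numerator and denominator of the
  duplication formula. The resultant identity bounds it: \<open>G\<close> divides
  \<open>16 * k' ^ 3 * b ^ 7\<close> and is prime to \<open>b\<close>, because \<open>N\<close> is
  congruent to \<open>a\<^sup>2\<close> modulo \<open>b\<close>. The size bound then follows from
  \<open>N >= k' * b\<^sup>2\<close>.\<close>

lemma B_4_bound:
  assumes "0 < m"
  shows "A (2 * m) dvd ((A m)\<^sup>2 + T\<^sup>2 * (B m)\<^sup>2)\<^sup>2" "B m ^ 4 \<le> 16 * T\<^sup>2 * \<bar>A (2 * m)\<bar>"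
proof -
  define a b k' N where v: "a = A m" "b = B m" "k' = T\<^sup>2" "N = a\<^sup>2 + k' * b\<^sup>2"
  have e: "B (2 * m) * N\<^sup>2 = 4 * a * b * (a\<^sup>2 - k' * b\<^sup>2) * A (2 * m)"
    using int_sum[of m m, unfolded mult_2[symmetric]]
    by (simp add: A_0 B_0 v power2_eq_square algebra_simps)
  have c: "coprime (A (2 * m)) (B (2 * m))" "coprime a b" using coprime_A_B by (auto simp: v)
  have "A (2 * m) dvd B (2 * m) * N\<^sup>2" unfolding e by simp
  then have d: "A (2 * m) dvd N\<^sup>2" using c by (simp add: coprime_dvd_mult_right_iff)
  then show "A (2 * m) dvd ((A m)\<^sup>2 + T\<^sup>2 * (B m)\<^sup>2)\<^sup>2" unfolding v .
  obtain G where G: "N\<^sup>2 = A (2 * m) * G" using d by blast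
  have "A (2 * m) * (B (2 * m) * G) = A (2 * m) * (4 * a * b * (a\<^sup>2 - k' * b\<^sup>2))"
    using e unfolding G by (simp add: algebra_simps)
  then have G': "4 * a * b * (a\<^sup>2 - k' * b\<^sup>2) = B (2 * m) * G"
    using A_nonzero[of "2 * m"] by simp
  \<comment> \<open>the resultant identity of numerator and denominator of the duplication formula\<close>
  have "- 16 * k' ^ 3 * b ^ 7 = (12 * a\<^sup>2 - 16 * k' * b\<^sup>2) * b * N\<^sup>2
      - (3 * a ^ 3 + 5 * k' * a * b\<^sup>2) * (4 * a * b * (a\<^sup>2 - k' * b\<^sup>2))"
    unfolding v(4) by algebra
  also have "G dvd \<dots>" unfolding G G' by simp
  finally have "G dvd 16 * k' ^ 3 * b ^ 7" by simp
  moreover have "coprime G (b ^ 7)"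
  proof -
    have "N = k' * b * b + a\<^sup>2" unfolding v(4) by algebra
    then have "gcd b N = gcd b (a\<^sup>2)" by (simp only: gcd_add_mult)
    moreover have "gcd b (a\<^sup>2) = 1" using c(2) by (simp add: coprime_commute flip: coprime_iff_gcd_eq_1)
    ultimately have "coprime N b" by (simp add: coprime_iff_gcd_eq_1 gcd.commute)
    then have "coprime (N\<^sup>2) b" by simp
    then show ?thesis unfolding G by simp
  qed
  ultimately have "G dvd 16 * k' ^ 3" by (simp add: coprime_dvd_mult_left_iff)
  moreover have k': "k' > 0" using T_pos by (simp add: v)
  ultimately have "\<bar>G\<bar> \<le> 16 * k' ^ 3" by (metis abs_of_pos dvd_imp_le_int mult_pos_pos order_less_imp_not_eq2 zero_less_numeral zero_less_power)
  have "k'\<^sup>2 * b ^ 4 = (k' * b\<^sup>2)\<^sup>2" by algebra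
  also have "\<dots> \<le> N\<^sup>2" unfolding v(4) using k' by (intro power_mono) auto
  also have "\<dots> = \<bar>A (2 * m)\<bar> * \<bar>G\<bar>" using G by (metis abs_mult abs_power2)
  also have "\<dots> \<le> \<bar>A (2 * m)\<bar> * (16 * k' ^ 3)" using \<open>\<bar>G\<bar> \<le> 16 * k' ^ 3\<close> by (intro mult_left_mono) auto
  also have "\<dots> = k'\<^sup>2 * (16 * k' * \<bar>A (2 * m)\<bar>)" by (simp add: power2_eq_square power3_eq_cube)
  finally show "B m ^ 4 \<le> 16 * T\<^sup>2 * \<bar>A (2 * m)\<bar>" using k' by (simp add: v)
qed

lemma A_double_upper:
  assumes "0 < m"
  shows "\<bar>A (2 * m)\<bar> \<le> ((A m)\<^sup>2 + T\<^sup>2 * (B m)\<^sup>2)\<^sup>2"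
proof -
  have "(A m)\<^sup>2 + T\<^sup>2 * (B m)\<^sup>2 > 0" using A_nonzero[of m] by (simp add: add_pos_nonneg)
  then show ?thesis using B_4_bound(1)[OF assms] by (metis dvd_imp_le_int abs_power2 power2_eq_square zero_less_power order_less_imp_not_eq2)
qed

text \<open>If \<open>X n\<close> is a square, the curve equation makes
  \<open>(A n)\<^sup>2 - (T * B n)\<^sup>2\<close> a square \<open>C\<^sup>2\<close> too. Distinct
  squares below \<open>(A n)\<^sup>2\<close> lie at least \<open>2 * A n - 1\<close> away, so
  \<open>A n <= (T * B n)\<^sup>2\<close>.\<close>

lemma A_upper_if_square:
  assumes "0 < n" "X n = r\<^sup>2"
  shows "\<bar>A (2 * n)\<bar> \<le> 4 * T ^ 8 * B n ^ 8"
proof -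
  obtain a b where ab: "A n = a\<^sup>2" "B n = b\<^sup>2" "b > 0"
    using square_fraction[OF coprime_A_B B_pos] assms X_eq[OF assms(1)] by metis
  have A0: "A n > 0" using A_nonzero[of n] ab by (simp add: zero_less_power2)
  have a0: "a \<noteq> 0" using A0 ab by auto
  obtain c where c: "c\<^sup>2 = A n * ((A n)\<^sup>2 - T\<^sup>2 * (B n)\<^sup>2) * B n" using A_B_square assms by blast
  have "of_int ((A n)\<^sup>2 - T\<^sup>2 * (B n)\<^sup>2) = (of_int c / of_int (a * b) :: rat)\<^sup>2"
  proof -
    have "(of_int c)\<^sup>2 = of_int ((A n)\<^sup>2 - T\<^sup>2 * (B n)\<^sup>2) * (of_int (a * b) :: rat)\<^sup>2"
      unfolding of_int_power[symmetric] c of_int_mult[symmetric] of_int_eq_iff ab by algebra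
    then show ?thesis using a0 ab by (simp add: power_divide eq_divide_eq)
  qed
  then obtain C where C: "(A n)\<^sup>2 - T\<^sup>2 * (B n)\<^sup>2 = C\<^sup>2" using square_int_if_square_rat by metis
  have TB: "T * B n > 0" using T_pos B_pos[OF assms(1)] by simp
  then have "0 < (T * B n)\<^sup>2" by (rule zero_less_power)
  then have "\<bar>C\<bar>\<^sup>2 < (A n)\<^sup>2" using C unfolding power_mult_distrib by simp
  then have "\<bar>C\<bar> \<le> A n - 1" using A0 by (smt (verit) power_mono)
  then have "\<bar>C\<bar>\<^sup>2 \<le> (A n - 1)\<^sup>2" by (intro power_mono) auto
  then have "(T * B n)\<^sup>2 \<ge> 2 * A n - 1" using C by (simp add: power_mult_distrib power2_eq_square algebra_simps)
  then have l: "A n \<le> (T * B n)\<^sup>2" using A0 by linarith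
  have "T\<^sup>2 * (B n)\<^sup>2 \<le> (A n)\<^sup>2" using C zero_le_power2[of C] by linarith
  have "\<bar>A (2 * n)\<bar> \<le> ((A n)\<^sup>2 + T\<^sup>2 * (B n)\<^sup>2)\<^sup>2" by (rule A_double_upper[OF assms(1)])
  also have "\<dots> \<le> (2 * (A n)\<^sup>2)\<^sup>2" using \<open>T\<^sup>2 * (B n)\<^sup>2 \<le> (A n)\<^sup>2\<close> by (intro power_mono) auto
  also have "\<dots> = 4 * A n ^ 4" by algebra
  also have "\<dots> \<le> 4 * ((T * B n)\<^sup>2) ^ 4" using l A0 by (intro mult_left_mono power_mono) auto
  also have "\<dots> = 4 * T ^ 8 * B n ^ 8" by (simp add: power_mult_distrib)
  finally show ?thesis .
qed

text \<open>A point of negative abscissa lies on the compact real component, where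
  \<open>-T <= x\<close>; so the numerator is at most \<open>T * B n\<close> in absolute
  value.\<close>

lemma A_upper_if_negative:
  assumes "0 < n" "X n < 0"
  shows "\<bar>A (2 * n)\<bar> \<le> 4 * T ^ 4 * B n ^ 4"
proof -
  have B: "B n > 0" using B_pos[OF assms(1)] .
  have A: "A n < 0" using assms(2) B unfolding X_eq[OF assms(1)] by (simp add: divide_less_0_iff)
  obtain c where c: "c\<^sup>2 = A n * ((A n)\<^sup>2 - T\<^sup>2 * (B n)\<^sup>2) * B n" using A_B_square assms by blast
  then have "0 \<le> A n * ((A n)\<^sup>2 - T\<^sup>2 * (B n)\<^sup>2) * B n" by (metis zero_le_power2)
  then have "(A n)\<^sup>2 \<le> T\<^sup>2 * (B n)\<^sup>2" using A B by (simp add: zero_le_mult_iff)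
  have "\<bar>A (2 * n)\<bar> \<le> ((A n)\<^sup>2 + T\<^sup>2 * (B n)\<^sup>2)\<^sup>2" by (rule A_double_upper[OF assms(1)])
  also have "\<dots> \<le> (2 * (T\<^sup>2 * (B n)\<^sup>2))\<^sup>2" using \<open>(A n)\<^sup>2 \<le> T\<^sup>2 * (B n)\<^sup>2\<close> by (intro power_mono) auto
  also have "\<dots> = 4 * T ^ 4 * B n ^ 4" by algebra
  finally show ?thesis .
qed

end

section \<open>Doubled points for squarefree \<open>T\<close> and their height inequality\<close>

locale squarefree_congruent_point = congruent_point +
  assumes squarefree_T: "squarefree T"
begin

lemma even_multiple:
  assumes "0 < m"
  obtains u v s w where "A (2 * m) = u\<^sup>2" "B (2 * m) = v\<^sup>2" "v > 0" "even v"
    "u\<^sup>2 - T * v\<^sup>2 = s\<^sup>2" "u\<^sup>2 + T * v\<^sup>2 = w\<^sup>2" "coprime u v" "s \<noteq> 0"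
proof -
  have m2: "0 < 2 * m" using assms by simp
  obtain r1 r2 r3 where r: "X (2 * m) = r1\<^sup>2" "X (2 * m) - of_int T = r2\<^sup>2" "X (2 * m) + of_int T = r3\<^sup>2"
    using double_squares[OF assms] by blast
  obtain u v where uv: "A (2 * m) = u\<^sup>2" "B (2 * m) = v\<^sup>2" "v > 0"
    using square_fraction[OF coprime_A_B B_pos[OF m2]] r(1) X_eq[OF m2] by metis
  have X: "X (2 * m) * (of_int v)\<^sup>2 = (of_int u)\<^sup>2"
    using X_eq[OF m2] uv by simp
  have "of_int (u\<^sup>2 - T * v\<^sup>2) = (r2 * of_int v)\<^sup>2"
    using X r(2) by (simp add: power_mult_distrib algebra_simps flip: r(2))
  then obtain s where s: "u\<^sup>2 - T * v\<^sup>2 = s\<^sup>2" using square_int_if_square_rat by metis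
  have "of_int (u\<^sup>2 + T * v\<^sup>2) = (r3 * of_int v)\<^sup>2"
    using X r(3) by (simp add: power_mult_distrib algebra_simps flip: r(3))
  then obtain w where w: "u\<^sup>2 + T * v\<^sup>2 = w\<^sup>2" using square_int_if_square_rat by metis
  have cop: "coprime u v" using coprime_A_B[of "2 * m"] uv by simp
  \<comment> \<open>Otherwise \<open>2mP\<close> would be the 2-torsion point of abscissa
    \<open>T\<close>.\<close>
  have "s \<noteq> 0"
  proof
    assume "s = 0"
    then have "of_int (u\<^sup>2) = (of_int (T * v\<^sup>2) :: rat)" using s by simp
    then have "X (2 * m) * (of_int v)\<^sup>2 = of_int T * (of_int v)\<^sup>2" using X by simp
    then have "X (2 * m) = of_int T" using uv(3) by simp
    then show False using X_double(2)[OF m2] by (simp add: k_def power2_eq_square power3_eq_cube)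
  qed
  then show thesis using that uv even_if_squares_in_progression[OF s w squarefree_T] s w cop by blast
qed

text \<open>These absorb all constants later: 25 exceeds \<open>exp 3\<close>, and
  \<open>B 2 >= 4\<close> with \<open>T * B 2 < A 2\<close> gives \<open>4 * T <= A 2\<close>.
  Parity and coprimality to \<open>T\<close> express nonsingular reduction at every prime.\<close>

lemma even_multiple_bounds:
  assumes "0 < m"
  shows "25 \<le> A (2 * m)" "4 \<le> B (2 * m)" "T * B (2 * m) < A (2 * m)" "even (B (2 * m))" "coprime (A (2 * m)) T"
proof -
  obtain u v s w where h: "A (2 * m) = u\<^sup>2" "B (2 * m) = v\<^sup>2" "v > 0" "even v"
    "u\<^sup>2 - T * v\<^sup>2 = s\<^sup>2" "u\<^sup>2 + T * v\<^sup>2 = w\<^sup>2" "coprime u v" "s \<noteq> 0"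
    using even_multiple[OF assms] by blast
  show "even (B (2 * m))" using h by simp
  have v2: "2 \<le> v" using h(3,4) by presburger
  have "2\<^sup>2 \<le> v\<^sup>2" using v2 by (intro power_mono) auto
  then show v4: "4 \<le> B (2 * m)" using h by simp
  have "0 < s\<^sup>2" using h(8) by simp
  then show lt: "T * B (2 * m) < A (2 * m)" unfolding h(1,2) using h(5) by linarith
  have odd_u: "odd u" using h(4,7) coprime_common_divisor[of u v 2] by auto
  \<comment> \<open>As \<open>u\<close> is odd, only the squares 1 and 9 must be excluded. From
    \<open>4 * T <= T * v\<^sup>2 < u\<^sup>2\<close> there remain \<open>T = 1\<close> and
    \<open>T = 2\<close> with \<open>v = 2\<close>, for which \<open>w\<^sup>2\<close> would be 13
    or 17.\<close>
  show "25 \<le> A (2 * m)"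
  proof (rule ccontr)
    assume "\<not> 25 \<le> A (2 * m)"
    then have "\<bar>u\<bar>\<^sup>2 < 5\<^sup>2" using h(1) by simp
    then have "\<bar>u\<bar> < 5" by (rule power_less_imp_less_base) simp
    then have "u \<in> {-4, -3, -2, -1, 0, 1, 2, 3, 4}" by auto
    then have u: "u\<^sup>2 = 1 \<or> u\<^sup>2 = 9" using odd_u by auto
    have "4 * T \<le> T * v\<^sup>2" using v4 h(2) T_pos by simp
    moreover have "T * v\<^sup>2 < u\<^sup>2" using lt h by simp
    ultimately have uT: "u\<^sup>2 = 9" "T = 1 \<or> T = 2" using T_pos u by linarith+
    have "v\<^sup>2 < 3\<^sup>2" using \<open>T * v\<^sup>2 < u\<^sup>2\<close> uT by auto
    then have "v < 3" by (rule power_less_imp_less_base) simp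
    then have "v = 2" using v2 by simp
    then have "w\<^sup>2 = 13 \<or> w\<^sup>2 = 17" using uT h(6) by auto
    moreover have "\<bar>w\<bar> < 5"
      using calculation by (intro power_less_imp_less_base[of "\<bar>w\<bar>" 2 5]) auto
    then have "w \<in> {-4, -3, -2, -1, 0, 1, 2, 3, 4}" by auto
    ultimately show False by auto
  qed
  \<comment> \<open>A common prime divides \<open>u\<close> and \<open>s\<close>, so its square
    divides \<open>T * v\<^sup>2\<close>; since \<open>v\<close> is prime to \<open>u\<close>, its
    square divides \<open>T\<close>.\<close>
  show "coprime (A (2 * m)) T"
  proof (rule ccontr)
    assume "\<not> coprime (A (2 * m)) T"
    then have "\<not> is_unit (gcd (u\<^sup>2) T)" unfolding h(1) by (simp add: coprime_iff_gcd_eq_1)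
    moreover have "gcd (u\<^sup>2) T \<noteq> 0" using T_pos by simp
    ultimately obtain p where "p dvd gcd (u\<^sup>2) T" "prime p" using prime_divisorE by metis
    then have p: "prime p" "p dvd u\<^sup>2" "p dvd T" by auto
    have pu: "p dvd u" using p prime_dvd_power by blast
    have "p dvd s\<^sup>2" unfolding h(5)[symmetric] using p by simp
    then have ps: "p dvd s" using p prime_dvd_power by blast
    have "p\<^sup>2 dvd u\<^sup>2 - s\<^sup>2" using pu ps by simp
    then have "p\<^sup>2 dvd T * v\<^sup>2" using h(5) by (simp add: algebra_simps)
    moreover have "\<not> p dvd v" using h(7) pu p by (meson coprime_common_divisor not_prime_unit)
    then have "coprime (p\<^sup>2) (v\<^sup>2)" using p by (simp add: prime_imp_coprime)
    ultimately have "p\<^sup>2 dvd T" by (simp add: coprime_dvd_mult_left_iff)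
    then have "is_unit p" using squarefree_T by (simp add: squarefree_def)
    then show False using p not_prime_unit by blast
  qed
qed

text \<open>The sum and product relations say that the triples
  \<open>(a1 * a2, b1 * a2 + b2 * a1, b1 * b2)\<close> and \<open>(N\<^sup>2, M, D\<^sup>2)\<close>
  are proportional. Both are primitive, by \<open>prim1\<close> and \<open>prim2\<close>, so their
  positive first entries agree.\<close>

lemma A_even_product:
  assumes "0 < n" "n \<le> m"
  shows "A (2 * (m + n)) * A (2 * (m - n)) = (A (2 * m) * A (2 * n) + T\<^sup>2 * B (2 * m) * B (2 * n))\<^sup>2"
proof -
  define a b c d a1 b1 a2 b2 where v: "a = A (2 * m)" "b = B (2 * m)" "c = A (2 * n)" "d = B (2 * n)"
    "a1 = A (2 * (m + n))" "b1 = B (2 * (m + n))" "a2 = A (2 * (m - n))" "b2 = B (2 * (m - n))"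
  define N M D where w: "N = a * c + T\<^sup>2 * b * d" "M = 2 * (b * c + d * a) * (a * c - T\<^sup>2 * b * d)" "D = b * c - d * a"
  have idx: "2 * m + 2 * n = 2 * (m + n)" "2 * m - 2 * n = 2 * (m - n)" "2 * n \<le> 2 * m" using assms by auto
  have s: "(b1 * a2 + b2 * a1) * N\<^sup>2 = M * (a1 * a2)"
    using int_sum[OF idx(3)] unfolding idx v w .
  have p: "b1 * b2 * N\<^sup>2 = D\<^sup>2 * (a1 * a2)"
    using int_product[OF idx(3)] unfolding idx v w .
  have N: "N \<noteq> 0" using denominator_nonzero[OF idx(3)] unfolding v w .
  have m: "0 < m" using assms by simp
  note bm = even_multiple_bounds[OF m, folded v] and bn = even_multiple_bounds[OF assms(1), folded v]
  have cop: "coprime a b" "coprime c d" "coprime a1 b1" "coprime a2 b2" using coprime_A_B by (auto simp: v)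
  have pos: "a1 > 0" using even_multiple_bounds(1)[of "m + n"] m by (simp add: v)
  have pos': "a2 > 0"
  proof (cases "m = n")
    case True
    then show ?thesis by (simp add: v A_0)
  next
    case False
    then have "0 < m - n" using assms by simp
    then show ?thesis using even_multiple_bounds(1)[of "m - n"] by (simp add: v)
  qed
  have prim1: False if q: "prime q" "q dvd a1 * a2" "q dvd b1 * a2 + b2 * a1" "q dvd b1 * b2" for q
  proof -
    have nu: "\<not> is_unit q" using q not_prime_unit by blast
    have c1: "\<not> (q dvd a1 \<and> q dvd b1)" "\<not> (q dvd a2 \<and> q dvd b2)"
      using cop nu by (meson coprime_common_divisor)+
    show False
    proof (cases "q dvd a1")
      case True
      then have "q dvd b2" using c1 q by (auto simp: prime_dvd_mult_iff)
      have "q dvd b1 * a2" using q(3) True by (simp add: dvd_add_left_iff)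
      then show False using c1 True \<open>q dvd b2\<close> q by (auto simp: prime_dvd_mult_iff)
    next
      case False
      then have a2: "q dvd a2" using q by (auto simp: prime_dvd_mult_iff)
      then have "q dvd b2 * a1" using q(3) by (simp add: dvd_add_right_iff)
      then show False using c1 False a2 q by (auto simp: prime_dvd_mult_iff)
    qed
  qed
  \<comment> \<open>A common prime divides none of \<open>a\<close>, \<open>c\<close>,
    \<open>d\<close>, where \<open>a\<close> needs coprimality to \<open>T\<close>, and it is not 2
    because \<open>N\<close> is odd. Yet \<open>8 * a\<^sup>2 * c * d\<close> is a combination of
    \<open>M\<close>, \<open>N\<close> and \<open>D\<close>.\<close>
  have prim2: False if q: "prime q" "q dvd N\<^sup>2" "q dvd M" "q dvd D\<^sup>2" for q
  proof -
    have nu: "\<not> is_unit q" using q not_prime_unit by blast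
    have qN: "q dvd N" and qD: "q dvd D" using q prime_dvd_power by blast+
    have nd: "\<not> (q dvd a \<and> q dvd b)" "\<not> (q dvd c \<and> q dvd d)" "\<not> (q dvd a \<and> q dvd T)" "\<not> (q dvd c \<and> q dvd T)"
      using cop bm bn nu by (meson coprime_common_divisor)+
    have Deq: "b * c = D + d * a" and Neq: "T\<^sup>2 * b * d = N - a * c" by (simp_all add: w)
    have na: "\<not> q dvd a"
    proof
      assume a: "q dvd a"
      then have "q dvd b * c" unfolding Deq using qD by simp
      then have c: "q dvd c" using nd a q by (auto simp: prime_dvd_mult_iff)
      have "q dvd T\<^sup>2 * b * d" unfolding Neq using qN a by simp
      then show False using nd a c q by (auto simp: prime_dvd_mult_iff prime_dvd_power_iff)
    qed
    have nc: "\<not> q dvd c"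
    proof
      assume c: "q dvd c"
      have "q dvd d * a" using Deq c qD by (metis dvd_add_right_iff dvd_mult)
      then show False using na nd c q by (auto simp: prime_dvd_mult_iff)
    qed
    have ndd: "\<not> q dvd d"
    proof
      assume d: "q dvd d"
      then have "q dvd a * c" using qN unfolding w by (simp add: dvd_add_left_iff)
      then show False using na nc q by (auto simp: prime_dvd_mult_iff)
    qed
    have "odd a" "odd c"
      using bm(4) bn(4) coprime_common_divisor[OF cop(1), of 2] coprime_common_divisor[OF cop(2), of 2] by auto
    then have "odd N" using bm(4) unfolding w by simp
    have n2: "\<not> q dvd 2"
    proof
      assume "q dvd 2"
      then have "q = 2" using zdvd_imp_le[of q 2] prime_ge_2_int[OF q(1)] by simp
      then show False using qN \<open>odd N\<close> by simp
    qed
    have "M - 8 * a\<^sup>2 * c * d = 4 * a * c * D - 2 * (D + 2 * a * d) * N"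
      unfolding w by algebra
    then have "8 * a\<^sup>2 * c * d = M - 4 * a * c * D + 2 * (D + 2 * a * d) * N" by simp
    also have "q dvd \<dots>" using q qN qD by (intro dvd_add dvd_diff) auto
    finally have "q dvd 8 * a\<^sup>2 * c * d" .
    moreover have "\<not> q dvd 8" using n2 q prime_dvd_power[of q 2 3] by auto
    ultimately show False using na nc ndd q by (simp add: prime_dvd_mult_iff prime_dvd_power_iff)
  qed
  have s': "a1 * a2 * M = (b1 * a2 + b2 * a1) * N\<^sup>2" and p': "a1 * a2 * D\<^sup>2 = b1 * b2 * N\<^sup>2"
    using s p by (simp_all only: mult.commute)
  have "N\<^sup>2 dvd a1 * a2"
  proof (rule dvd_if_dvd_mult_coprime_triple[of "N\<^sup>2" M "D\<^sup>2"])
    show False if "prime q" "q dvd N\<^sup>2" "q dvd M" "q dvd D\<^sup>2" for q using prim2 that .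
    show "N\<^sup>2 dvd a1 * a2 * M" "N\<^sup>2 dvd a1 * a2 * D\<^sup>2" unfolding s' p' by simp_all
  qed (use N in auto)
  moreover have "a1 * a2 dvd N\<^sup>2"
  proof (rule dvd_if_dvd_mult_coprime_triple[of "a1 * a2" "b1 * a2 + b2 * a1" "b1 * b2"])
    show False if "prime q" "q dvd a1 * a2" "q dvd b1 * a2 + b2 * a1" "q dvd b1 * b2" for q using prim1 that .
    have "N\<^sup>2 * (b1 * a2 + b2 * a1) = M * (a1 * a2)" "N\<^sup>2 * (b1 * b2) = D\<^sup>2 * (a1 * a2)"
      using s p by (simp_all only: mult.commute)
    then show "a1 * a2 dvd N\<^sup>2 * (b1 * a2 + b2 * a1)" "a1 * a2 dvd N\<^sup>2 * (b1 * b2)" by simp_all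
  qed (use pos pos' in auto)
  moreover have "0 \<le> a1 * a2" using pos pos' by simp
  ultimately have "a1 * a2 = N\<^sup>2" by (simp add: zdvd_antisym_nonneg)
  then show ?thesis by (simp add: v w)
qed

text \<open>Induction by halving \<open>j\<close>, using
  \<open>(H_m H_n)^2 <= H_(m+n) H_(m-n)\<close>. For \<open>j = 2 * i\<close> take both indices
  \<open>i * r\<close>; for \<open>j = 2 * i + 1\<close> take \<open>(i + 1) * r\<close> and
  \<open>i * r\<close>, where the exponents add up to \<open>j\<^sup>2 + 1\<close> and the surplus
  cancels against the difference index \<open>r\<close>.\<close>

lemma A_even_growth:
  assumes "0 < r"
  shows "A (2 * r) ^ (j\<^sup>2) \<le> A (2 * (j * r))"
proof (induction j rule: less_induct)
  case (less j)
  have base: "1 \<le> A (2 * r)" using even_multiple_bounds(1)[OF assms] by simp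
  have ge: "(A (2 * m))\<^sup>2 * (A (2 * n))\<^sup>2 \<le> A (2 * (m + n)) * A (2 * (m - n))" if "0 < n" "n \<le> m" for m n
  proof -
    have "1 \<le> A (2 * m) * A (2 * n)" "0 \<le> T\<^sup>2 * B (2 * m) * B (2 * n)"
      using even_multiple_bounds(1)[of m] even_multiple_bounds(1)[of n] B_pos[of "2 * m"] B_pos[of "2 * n"] that
       mult_mono[of 1 "A (2 * m)" 1 "A (2 * n)"] by auto
    then show ?thesis unfolding A_even_product[OF that] power_mult_distrib[symmetric]
      by (intro power_mono) auto
  qed
  define H where "H i = A (2 * (i * r))" for i
  consider "j = 0" | "j = 1" | i where "j = 2 * i" "0 < i" | i where "j = 2 * i + 1" "0 < i"
  proof -
    have "j = 0 \<or> j = 1 \<or> (\<exists>i>0. j = 2 * i) \<or> (\<exists>i>0. j = 2 * i + 1)" by presburger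
    then show ?thesis using that by blast
  qed
  then show ?case
  proof cases
    case 1
    then show ?thesis by (simp add: A_0)
  next
    case 2
    then show ?thesis by simp
  next
    case (3 i)
    have "A (2 * r) ^ (i\<^sup>2) \<le> H i" unfolding H_def using less.IH[of i] 3 by simp
    then have "(A (2 * r) ^ (i\<^sup>2)) ^ 4 \<le> H i ^ 4" using base by (intro power_mono) auto
    also have "\<dots> = (A (2 * (i * r)))\<^sup>2 * (A (2 * (i * r)))\<^sup>2"
      by (simp add: H_def flip: power_add)
    also have "\<dots> \<le> A (2 * (i * r + i * r)) * A (2 * (i * r - i * r))"
      using 3 assms by (intro ge) auto
    also have "i * r + i * r = j * r" by (simp add: 3)
    finally have "(A (2 * r) ^ (i\<^sup>2)) ^ 4 \<le> A (2 * (j * r))" by (simp add: A_0)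
    moreover have "i\<^sup>2 * 4 = j\<^sup>2" by (simp add: 3 power2_eq_square)
    ultimately show ?thesis unfolding power_mult[symmetric] by simp
  next
    case (4 i)
    have h: "A (2 * r) ^ (i\<^sup>2) \<le> H i" "A (2 * r) ^ ((i + 1)\<^sup>2) \<le> H (i + 1)"
      unfolding H_def using less.IH[of i] less.IH[of "i + 1"] 4 by simp_all
    have "A (2 * r) ^ (j\<^sup>2) * A (2 * r) = (A (2 * r) ^ ((i + 1)\<^sup>2))\<^sup>2 * (A (2 * r) ^ (i\<^sup>2))\<^sup>2"
      unfolding 4 power_mult[symmetric] power_add[symmetric] power_Suc2[symmetric]
      by (rule arg_cong[of _ _ "power _"]) (simp add: power2_eq_square)
    also have "\<dots> \<le> (H (i + 1))\<^sup>2 * (H i)\<^sup>2"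
      using h base by (intro mult_mono power_mono) auto
    also have "\<dots> \<le> A (2 * ((i + 1) * r + i * r)) * A (2 * ((i + 1) * r - i * r))"
      unfolding H_def using 4 assms by (intro ge) auto
    also have "(i + 1) * r + i * r = j * r" by (simp add: 4 add_mult_distrib)
    also have "(i + 1) * r - i * r = r" by simp
    finally show ?thesis using base by simp
  qed
qed

end

section \<open>Numerical estimates\<close>

text \<open>With \<open>q = 2 * i + 1\<close>, the inequality
  \<open>4 * i * (i + 1) <= q\<^sup>2\<close> lets the sum telescope from \<open>i = a\<close>
  on.\<close>

lemma sum_inverse_odd_squares_le:
  fixes F :: "nat set"
  assumes "finite F" "0 < a" and F: "\<And>q. q \<in> F \<Longrightarrow> odd q \<and> 2 * a + 1 \<le> q"
  shows "(\<Sum>q\<in>F. 1 / (real q)\<^sup>2) \<le> 1 / (4 * real a)"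
proof -
  obtain N where N: "\<And>q. q \<in> F \<Longrightarrow> q < N" using assms(1) finite_nat_set_iff_bounded by auto
  have tele: "(\<Sum>i=a..<a + n. 1 / (real (2 * i + 1))\<^sup>2) \<le> (1 / real a - 1 / real (a + n)) / 4" for n
  proof (induction n)
    case (Suc n)
    have p: "0 < real (a + n)" using assms(2) by simp
    have "4 * (real (a + n) * (real (a + n) + 1)) \<le> (real (2 * (a + n) + 1))\<^sup>2"
      by (simp add: power2_eq_square algebra_simps)
    then have "1 / (real (2 * (a + n) + 1))\<^sup>2 \<le> 1 / (4 * (real (a + n) * (real (a + n) + 1)))"
      using p by (intro divide_left_mono) auto
    also have "\<dots> = (1 / real (a + n) - 1 / real (a + Suc n)) / 4"
      using p by (simp add: field_simps)
    finally show ?case using Suc by simp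
  qed simp
  have sub: "F \<subseteq> (\<lambda>i. 2 * i + 1) ` {a..<a + N}"
  proof
    fix q assume q: "q \<in> F"
    then obtain i where "q = 2 * i + 1" using F by (metis oddE)
    then show "q \<in> (\<lambda>i. 2 * i + 1) ` {a..<a + N}" using F[OF q] N[OF q] by auto
  qed
  have "(\<Sum>q\<in>F. 1 / (real q)\<^sup>2) \<le> (\<Sum>q\<in>(\<lambda>i. 2 * i + 1) ` {a..<a + N}. 1 / (real q)\<^sup>2)"
    using sub by (intro sum_mono2) auto
  also have "\<dots> = (\<Sum>i=a..<a + N. 1 / (real (2 * i + 1))\<^sup>2)"
    by (subst sum.reindex) (auto simp: inj_on_def)
  also have "\<dots> \<le> (1 / real a - 1 / real (a + N)) / 4" by (rule tele)
  also have "\<dots> \<le> 1 / (4 * real a)" by (simp add: field_simps)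
  finally show ?thesis .
qed

text \<open>The tangent of \<open>ln\<close> at \<open>2 ^ j\<close>, with a rational upper bound
  for \<open>ln 2\<close>; a larger \<open>j\<close> gives a smaller slope.\<close>

lemma ln_le_linear:
  assumes "0 < (x :: real)"
  shows "ln x \<le> x / 2 ^ j - 1 + real j * (25 / 36)"
proof -
  have "ln x = ln (x / 2 ^ j) + real j * ln 2" using assms by (simp add: ln_div ln_realpow)
  also have "ln (x / 2 ^ j) \<le> x / 2 ^ j - 1" using assms by (intro ln_le_minus_one) simp
  also have "real j * ln 2 \<le> real j * (25 / 36)" using ln2_le_25_over_36 by (intro mult_left_mono) auto
  finally show ?thesis by simp
qed

lemma prime_factors_natD:
  assumes "q \<in> prime_factors (n :: nat)"
  shows "prime q" "q dvd n" "2 \<le> q" "0 < n" "0 < n div q" "n = q * (n div q)"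
proof -
  show q: "prime q" "q dvd n" using assms by auto
  show n: "0 < n" using assms by (cases n) auto
  show "2 \<le> q" using q prime_ge_2_nat by blast
  show e: "n = q * (n div q)" using q by simp
  show "0 < n div q" using e n by (cases "n div q") auto
qed

lemma prod_prime_factors_le:
  assumes "0 < (n :: nat)"
  shows "(\<Prod>q\<in>prime_factors n. q) \<le> n"
proof -
  have "(\<Prod>q\<in>prime_factors n. q) \<le> (\<Prod>q\<in>prime_factors n. q ^ multiplicity q n)"
  proof (rule prod_mono)
    fix q assume q: "q \<in> prime_factors n"
    then have "0 < multiplicity q n" by (simp add: prime_factors_multiplicity)
    moreover have "0 < q" using prime_factors_natD[OF q] by simp
    ultimately have "q ^ 1 \<le> q ^ multiplicity q n" by (intro power_increasing) auto
    then show "0 \<le> q \<and> q \<le> q ^ multiplicity q n" by simp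
  qed
  also have "\<dots> = n" using assms prime_factorization_nat[of n] by simp
  finally show ?thesis .
qed

lemma sum_ln_prime_factors_le:
  assumes "0 < (n :: nat)"
  shows "(\<Sum>q\<in>prime_factors n. ln (real q)) \<le> ln (real n)"
proof -
  have pos: "0 < q" if "q \<in> prime_factors n" for q using prime_factors_natD(3)[OF that] by simp
  have "(\<Sum>q\<in>prime_factors n. ln (real q)) = ln (\<Prod>q\<in>prime_factors n. real q)"
    using pos by (subst ln_prod) auto
  also have "(\<Prod>q\<in>prime_factors n. real q) = real (\<Prod>q\<in>prime_factors n. q)" by simp
  also have "ln \<dots> \<le> ln (real n)"
  proof -
    have "0 < (\<Prod>q\<in>prime_factors n. q)" using pos by (intro prod_pos)
    then show ?thesis using prod_prime_factors_le[OF assms] assms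
      by (subst ln_le_cancel_iff) (simp_all del: of_nat_prod)
  qed
  finally show ?thesis .
qed

lemma card_prime_factors_le:
  assumes "0 < (n :: nat)"
  shows "real (card (prime_factors n)) \<le> 3 / 2 * ln (real n)"
proof -
  have "real (card (prime_factors n)) * (2 / 3) = (\<Sum>q\<in>prime_factors n. 2 / 3 :: real)" by simp
  also have "\<dots> \<le> (\<Sum>q\<in>prime_factors n. ln (real q))"
  proof (intro sum_mono)
    fix q assume "q \<in> prime_factors n"
    then have "2 \<le> q" by (rule prime_factors_natD)
    then have "ln 2 \<le> ln (real q)" by simp
    then show "2 / 3 \<le> ln (real q)" using ln2_ge_two_thirds by simp
  qed
  also have "\<dots> \<le> ln (real n)" by (rule sum_ln_prime_factors_le[OF assms])
  finally show ?thesis by simp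
qed

abbreviation inverse_square_sum :: "nat \<Rightarrow> real" where
  "inverse_square_sum n \<equiv> \<Sum>q\<in>prime_factors n. 1 / (real q)\<^sup>2"

lemma inverse_square_sum_odd:
  assumes "odd n"
  shows "inverse_square_sum n \<le> 1 / 4"
proof -
  have "odd q \<and> 2 * 1 + 1 \<le> q" if "q \<in> prime_factors n" for q
  proof -
    have "odd q" "2 \<le> q" using prime_factors_natD[OF that] assms dvd_trans by blast+
    then show ?thesis by (cases "q = 2") auto
  qed
  then show ?thesis using sum_inverse_odd_squares_le[of "prime_factors n" 1] by simp
qed

text \<open>The negation of what \<open>no_primitive_divisor_bound\<close> yields; 1/4 and 1/8 are
  the exponents in the lower bounds for \<open>B n\<close> for negative and for square abscissas. As
  the inverse square sum is at most 1/4, the brackets are at least 3/16 and 1/16, and quadratic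
  growth beats the linear bound.\<close>

lemma odd_numeric_bound:
  assumes "odd n"
  shows "5 \<le> n \<Longrightarrow> 2 / 3 * ln (real n) + real (card (prime_factors n)) / 2 + 1
      < (real n)\<^sup>2 * (1 / 4 - inverse_square_sum n / 4)"
    and "23 \<le> n \<Longrightarrow> 2 / 3 * ln (real n) + real (card (prime_factors n)) / 2 + 1
      < (real n)\<^sup>2 * (1 / 8 - inverse_square_sum n / 4)"
proof -
  have n: "0 < n" using assms by (cases n) auto
  have l: "2 / 3 * ln (real n) + real (card (prime_factors n)) / 2 + 1 \<le> 17 / 24 * real n + 1"
    using ln_le_linear[of "real n" 1] card_prime_factors_le[OF n] n by simp
  note S = inverse_square_sum_odd[OF assms]
  {
    assume "5 \<le> n"
    have "17 / 24 * real n + 1 < 15 / 16 * real n" using \<open>5 \<le> n\<close> by simp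
    also have "15 / 16 * real n \<le> (real n)\<^sup>2 * (3 / 16)"
      using \<open>5 \<le> n\<close> mult_right_mono[of 5 "real n" "real n"] by (simp add: power2_eq_square)
    also have "\<dots> \<le> (real n)\<^sup>2 * (1 / 4 - inverse_square_sum n / 4)"
      using S by (intro mult_left_mono) auto
    finally show "2 / 3 * ln (real n) + real (card (prime_factors n)) / 2 + 1
      < (real n)\<^sup>2 * (1 / 4 - inverse_square_sum n / 4)" using l by linarith
  }
  {
    assume "23 \<le> n"
    have "17 / 24 * real n + 1 < 23 / 16 * real n" using \<open>23 \<le> n\<close> by simp
    also have "23 / 16 * real n \<le> (real n)\<^sup>2 * (1 / 16)"
      using \<open>23 \<le> n\<close> mult_right_mono[of 23 "real n" "real n"] by (simp add: power2_eq_square)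
    also have "\<dots> \<le> (real n)\<^sup>2 * (1 / 8 - inverse_square_sum n / 4)"
      using S by (intro mult_left_mono) auto
    finally show "2 / 3 * ln (real n) + real (card (prime_factors n)) / 2 + 1
      < (real n)\<^sup>2 * (1 / 8 - inverse_square_sum n / 4)" using l by linarith
  }
qed

lemma prime_factors_ge_5:
  fixes q n :: nat
  assumes "q \<in> prime_factors n - {2, 3}"
  shows "odd q" "5 \<le> q"
proof -
  have q: "prime q" "q \<noteq> 2" "q \<noteq> 3" using assms by auto
  show "odd q" using q prime_odd_nat prime_ge_2_nat[of q] by force
  then show "5 \<le> q" using q prime_ge_2_nat[of q] by presburger
qed

text \<open>The primes 2 and 3 contribute up to 13/36, so the margin is thin and three cases are
  separated: \<open>n = 12\<close>; at most one prime factor from 5 on, with total at most 13/36 +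
  1/25 and \<open>n >= 14\<close>; and at least two such primes, where the tail is at most 1/8 but
  \<open>n >= 60\<close>.\<close>

lemma even_numeric_bound:
  assumes n: "even n" "12 \<le> n"
  shows "2 / 3 * ln (real n) + real (card (prime_factors n)) / 2 + 1
      < (real n)\<^sup>2 * (1 / 8 - inverse_square_sum n / 4)"
proof -
  define F where "F = prime_factors n - {2, 3}"
  have fin: "finite F" by (simp add: F_def)
  have "inverse_square_sum n \<le> (\<Sum>q\<in>{2, 3} \<union> F. 1 / (real q)\<^sup>2)"
    by (intro sum_mono2) (auto simp: F_def)
  also have "\<dots> = (\<Sum>q\<in>{2, 3}. 1 / (real q)\<^sup>2) + (\<Sum>q\<in>F. 1 / (real q)\<^sup>2)"
    using fin by (intro sum.union_disjoint) (auto simp: F_def)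
  also have "(\<Sum>q\<in>{2, 3::nat}. 1 / (real q)\<^sup>2) = 13 / 36" by simp
  finally have S: "inverse_square_sum n \<le> 13 / 36 + (\<Sum>q\<in>F. 1 / (real q)\<^sup>2)" .
  have "card (prime_factors n) \<le> card ({2, 3} \<union> F)"
    using fin by (intro card_mono) (auto simp: F_def)
  also have "\<dots> \<le> card {2, 3::nat} + card F" by (rule card_Un_le)
  finally have c: "card (prime_factors n) \<le> 2 + card F" by simp
  have mono: "(real n)\<^sup>2 * (1 / 8 - s / 4) \<le> (real n)\<^sup>2 * (1 / 8 - inverse_square_sum n / 4)"
    if "inverse_square_sum n \<le> s" for s
    using that by (intro mult_left_mono) auto
  show ?thesis
  proof (cases "card F \<le> 1")
    case True
    have "(\<Sum>q\<in>F. 1 / (real q)\<^sup>2) \<le> (\<Sum>q\<in>F. 1 / 25)"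
    proof (intro sum_mono)
      fix q assume "q \<in> F"
      then have "5 \<le> real q" using prime_factors_ge_5 unfolding F_def by fastforce
      then have "5\<^sup>2 \<le> (real q)\<^sup>2" by (intro power_mono) auto
      then show "1 / (real q)\<^sup>2 \<le> 1 / 25" using \<open>5 \<le> real q\<close> by (intro divide_left_mono) auto
    qed
    then have Fs: "(\<Sum>q\<in>F. 1 / (real q)\<^sup>2) \<le> real (card F) / 25" by simp
    show ?thesis
    proof (cases "n = 12")
      case True
      have "F = {}"
      proof (rule ccontr)
        assume "F \<noteq> {}"
        then obtain q where "q \<in> F" by blast
        then have "odd q" "5 \<le> q" "q dvd 2 ^ 2 * 3" "prime q"
          using prime_factors_ge_5[of q n] unfolding F_def True by auto
        then have "q dvd 3 \<or> q dvd 2" by (metis prime_dvd_mult_iff prime_dvd_power)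
        then show False using \<open>5 \<le> q\<close> by (auto dest: dvd_imp_le)
      qed
      then have "inverse_square_sum n \<le> 13 / 36" "card (prime_factors n) \<le> 2" using S c by simp_all
      then show ?thesis using mono[of "13 / 36"] ln_le_linear[of "real n" 2] True by simp
    next
      case False
      then have n14: "14 \<le> n" using n by presburger
      have s: "inverse_square_sum n \<le> 361 / 900" using S Fs True by simp
      have c3: "card (prime_factors n) \<le> 3" using c True by simp
      have "14 * real n \<le> (real n)\<^sup>2" using n14 by (simp add: power2_eq_square)
      moreover have "(real n)\<^sup>2 * (89 / 3600) \<le> (real n)\<^sup>2 * (1 / 8 - inverse_square_sum n / 4)"
        using mono[OF s] by simp
      moreover have "ln (real n) \<le> real n / 8 + 13 / 12" using ln_le_linear[of "real n" 3] n14 by simp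
      ultimately show ?thesis using c3 n14 by linarith
    qed
  next
    case False
    then obtain p q where pq: "p \<in> F" "q \<in> F" "p < q"
      by (metis card_le_Suc0_iff_eq fin One_nat_def linorder_neqE_nat)
    have pr: "prime p" "prime q" "p dvd n" "q dvd n" using pq by (auto simp: F_def)
    have "odd p" "5 \<le> p" "odd q" "5 \<le> q" using prime_factors_ge_5 pq unfolding F_def by blast+
    have "coprime p q" using pr pq by (simp add: primes_coprime)
    then have "p * q dvd n" using pr by (simp add: divides_mult)
    moreover have "coprime 2 (p * q)" using \<open>odd p\<close> \<open>odd q\<close> by simp
    ultimately have "2 * (p * q) dvd n" using n by (simp add: divides_mult)
    then have "2 * (p * q) \<le> n" using n by (intro dvd_imp_le) auto
    moreover have "5 * 6 \<le> p * q" using \<open>5 \<le> p\<close> pq by (intro mult_le_mono) auto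
    ultimately have n60: "60 \<le> n" by simp
    have "(\<Sum>q\<in>F. 1 / (real q)\<^sup>2) \<le> 1 / (4 * real 2)"
      using prime_factors_ge_5 by (intro sum_inverse_odd_squares_le fin) (auto simp: F_def)
    then have s: "inverse_square_sum n \<le> 35 / 72" using S by simp
    have "60 * real n \<le> (real n)\<^sup>2" using n60 by (simp add: power2_eq_square)
    moreover have "(real n)\<^sup>2 * (1 / 288) \<le> (real n)\<^sup>2 * (1 / 8 - inverse_square_sum n / 4)"
      using mono[OF s] by simp
    moreover have "ln (real n) \<le> real n / 32 + 89 / 36" using ln_le_linear[of "real n" 5] n60 by simp
    moreover have "real (card (prime_factors n)) \<le> 3 / 2 * ln (real n)"
      using card_prime_factors_le[of n] n60 by simp
    ultimately show ?thesis using n60 by linarith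
  qed
qed

section \<open>Height inequalities against the absence of primitive divisors\<close>

context squarefree_congruent_point
begin

definition h :: "nat \<Rightarrow> real" where "h n = ln (real_of_int (A (2 * n)))"

lemma A_even_pos: "0 < n \<Longrightarrow> 0 < A (2 * n)"
  using even_multiple_bounds(1)[of n] by simp

text \<open>The constant 3 allows \<open>2 * ln n <= 2 / 3 * ln n * h 1\<close>, so that
  \<open>h 1\<close> can be cancelled at the end.\<close>

lemma h_1_ge: "3 \<le> h 1"
proof -
  have "exp (3 :: real) = exp 1 ^ 3" by (simp flip: exp_of_nat_mult)
  also have "\<dots> \<le> (272 / 100) ^ 3" using e_less_272 by (intro power_mono) auto
  also have "\<dots> \<le> real_of_int (A 2)" using even_multiple_bounds(1)[of 1] by (simp add: power3_eq_cube)
  finally have "ln (exp 3) \<le> ln (real_of_int (A 2))" by (subst ln_le_cancel_iff) (use A_even_pos[of 1] in auto)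
  then show ?thesis by (simp add: h_def)
qed

lemma T_upper: "4 * T \<le> A 2"
proof -
  have "T * 4 \<le> T * B 2" using even_multiple_bounds(2)[of 1] T_pos by (intro mult_left_mono) auto
  then show ?thesis using even_multiple_bounds(3)[of 1] by simp
qed

lemma ln_T_upper: "ln 4 + ln (real_of_int T) \<le> h 1"
proof -
  have "ln 4 + ln (real_of_int T) = ln (real_of_int (4 * T))" using T_pos by (simp add: ln_mult)
  also have "\<dots> \<le> ln (real_of_int (A 2))"
    using T_upper T_pos by (subst ln_le_cancel_iff) (auto simp del: of_int_mult)
  finally show ?thesis by (simp add: h_def)
qed

lemma ln_4: "0 \<le> ln (4 :: real)" by simp

lemma h_growth:
  assumes "0 < r"
  shows "(real j)\<^sup>2 * h r \<le> h (j * r)"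
proof (cases "j = 0")
  case True
  then show ?thesis by (simp add: h_def A_0)
next
  case False
  have "(real j)\<^sup>2 * h r = ln (real_of_int (A (2 * r)) ^ (j\<^sup>2))"
    using A_even_pos[OF assms] by (simp add: h_def ln_realpow)
  also have "\<dots> \<le> ln (real_of_int (A (2 * (j * r))))"
    using A_even_growth[OF assms, of j] A_even_pos[OF assms] A_even_pos[of "j * r"] False assms
    by (subst ln_le_cancel_iff) (auto simp flip: of_int_power)
  finally show ?thesis by (simp add: h_def)
qed

lemma ln_B_upper:
  assumes "0 < m"
  shows "ln (real_of_int (B m)) \<le> h 1 / 2 + h m / 4"
proof -
  have p: "0 < A (2 * m)" "0 < A 2" "0 < B m" using A_even_pos[of 1] A_even_pos[OF assms] B_pos[OF assms] by auto
  have "B m ^ 4 \<le> 16 * T\<^sup>2 * A (2 * m)" using B_4_bound(2)[OF assms] p by simp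
  also have "16 * T\<^sup>2 = (4 * T)\<^sup>2" by algebra
  also have "(4 * T)\<^sup>2 * A (2 * m) \<le> (A 2)\<^sup>2 * A (2 * m)"
    using T_upper T_pos p by (intro mult_right_mono power_mono) auto
  finally have "real_of_int (B m ^ 4) \<le> real_of_int ((A 2)\<^sup>2 * A (2 * m))" by (simp only: of_int_le_iff)
  then have "ln (real_of_int (B m) ^ 4) \<le> ln (real_of_int (A 2) ^ 2 * real_of_int (A (2 * m)))"
    using p by (subst ln_le_cancel_iff) auto
  then show ?thesis using p by (simp add: h_def ln_mult ln_realpow)
qed

text \<open>Logarithms of the divisibility by the product over \<open>q\<close>: each
  \<open>ln (B (n div q))\<close> is at most \<open>h 1 / 2 + h n / (4 * q^2)\<close> by height
  growth. After moving the \<open>h n\<close> terms to one side, everything is a multiple of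
  \<open>h 1\<close>.\<close>

lemma no_primitive_divisor_bound:
  assumes n: "0 < n" and np: "\<not> (\<exists>p. primitive_divisor B n p)"
    and lower: "c * h n - h 1 \<le> ln (real_of_int (B n))" and c: "inverse_square_sum n / 4 \<le> c"
  shows "(real n)\<^sup>2 * (c - inverse_square_sum n / 4) \<le> 2 / 3 * ln (real n) + real (card (prime_factors n)) / 2 + 1"
proof -
  define S where "S = inverse_square_sum n"
  have h1: "0 < h 1" using h_1_ge by simp
  have q: "0 < q" "0 < n div q" "n = q * (n div q)" if "q \<in> prime_factors n" for q
    using prime_factors_natD[OF that] by simp_all
  have pos: "0 < (int q)\<^sup>2 * B (n div q)" if "q \<in> prime_factors n" for q
    using q[OF that] B_pos by simp
  have Bq: "B (n div q) > 0" "B (n div q) \<noteq> 0" if "q \<in> prime_factors n" for q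
    using B_pos[OF q(2)[OF that]] by simp_all
  have "B n \<le> (\<Prod>q\<in>prime_factors n. (int q)\<^sup>2 * B (n div q))"
    using B_dvd_prod_if_no_primitive_divisor[OF n np] pos by (intro zdvd_imp_le prod_pos)
  then have "real_of_int (B n) \<le> real_of_int (\<Prod>q\<in>prime_factors n. (int q)\<^sup>2 * B (n div q))" by (simp only: of_int_le_iff)
  also have "\<dots> = (\<Prod>q\<in>prime_factors n. (real q)\<^sup>2 * real_of_int (B (n div q)))" by simp
  finally have "ln (real_of_int (B n)) \<le> ln (\<Prod>q\<in>prime_factors n. (real q)\<^sup>2 * real_of_int (B (n div q)))"
    using B_pos[OF n] q(1) Bq by (subst ln_le_cancel_iff) (auto intro!: prod_pos)
  also have "\<dots> = (\<Sum>q\<in>prime_factors n. ln ((real q)\<^sup>2 * real_of_int (B (n div q))))"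
    using q(1) Bq by (subst ln_prod) auto
  also have "\<dots> \<le> (\<Sum>q\<in>prime_factors n. 2 * ln (real q) + (h 1 / 2 + h n / 4 * (1 / (real q)\<^sup>2)))"
  proof (intro sum_mono)
    fix q assume "q \<in> prime_factors n"
    note q = q[OF this]
    have "(real q)\<^sup>2 * h (n div q) \<le> h n" using h_growth[OF q(2), of q] q(3) by simp
    then have "h (n div q) \<le> h n * (1 / (real q)\<^sup>2)" using q(1) by (simp add: field_simps)
    then have "ln (real_of_int (B (n div q))) \<le> h 1 / 2 + h n / 4 * (1 / (real q)\<^sup>2)"
      using ln_B_upper[OF q(2)] by simp
    then show "ln ((real q)\<^sup>2 * real_of_int (B (n div q))) \<le> 2 * ln (real q) + (h 1 / 2 + h n / 4 * (1 / (real q)\<^sup>2))"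
      using q B_pos[OF q(2)] by (simp add: ln_mult ln_realpow)
  qed
  also have "\<dots> = 2 * (\<Sum>q\<in>prime_factors n. ln (real q)) + (real (card (prime_factors n)) * (h 1 / 2) + h n / 4 * S)"
    unfolding S_def by (simp only: sum.distrib sum_constant sum_distrib_left)
  also have "\<dots> \<le> 2 * ln (real n) + (real (card (prime_factors n)) * (h 1 / 2) + h n / 4 * S)"
    using sum_ln_prime_factors_le[OF n] by simp
  finally have "h n * (c - S / 4) \<le> 2 * ln (real n) + (real (card (prime_factors n)) / 2 + 1) * h 1"
    using lower by (simp add: algebra_simps)
  \<comment> \<open>Replacing \<open>h n\<close> by its lower bound \<open>n^2 * h 1\<close> is
    valid because the coefficient \<open>c - S / 4\<close> is nonnegative.\<close>
  moreover have "(real n)\<^sup>2 * h 1 * (c - S / 4) \<le> h n * (c - S / 4)"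
    using h_growth[of 1 n] c unfolding S_def by (intro mult_right_mono) auto
  moreover have "2 * ln (real n) \<le> 2 / 3 * ln (real n) * h 1"
    using h_1_ge n mult_left_mono[OF h_1_ge, of "2 / 3 * ln (real n)"] by simp
  ultimately have "h 1 * ((real n)\<^sup>2 * (c - S / 4)) \<le> h 1 * (2 / 3 * ln (real n) + real (card (prime_factors n)) / 2 + 1)"
    by (simp add: algebra_simps)
  then show ?thesis using h1 unfolding S_def by simp
qed

lemma ln_B_lower_if_square:
  assumes "0 < n" "X n = r\<^sup>2"
  shows "1 / 8 * h n - h 1 \<le> ln (real_of_int (B n))"
proof -
  have p: "0 < A (2 * n)" "0 < B n" using A_even_pos B_pos assms by auto
  have "A (2 * n) \<le> 4 * T ^ 8 * B n ^ 8" using A_upper_if_square[OF assms] p by simp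
  then have "real_of_int (A (2 * n)) \<le> real_of_int (4 * T ^ 8 * B n ^ 8)" by (simp only: of_int_le_iff)
  then have "h n \<le> ln (4 * real_of_int T ^ 8 * real_of_int (B n) ^ 8)"
    unfolding h_def using p T_pos by (subst ln_le_cancel_iff) auto
  also have "\<dots> = ln 4 + 8 * ln (real_of_int T) + 8 * ln (real_of_int (B n))"
    using p T_pos by (simp add: ln_mult ln_realpow)
  finally show ?thesis using ln_T_upper ln_4 by argo
qed

lemma ln_B_lower_if_negative:
  assumes "0 < n" "X n < 0"
  shows "1 / 4 * h n - h 1 \<le> ln (real_of_int (B n))"
proof -
  have p: "0 < A (2 * n)" "0 < B n" using A_even_pos B_pos assms by auto
  have "A (2 * n) \<le> 4 * T ^ 4 * B n ^ 4" using A_upper_if_negative[OF assms] p by simp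
  then have "real_of_int (A (2 * n)) \<le> real_of_int (4 * T ^ 4 * B n ^ 4)" by (simp only: of_int_le_iff)
  then have "h n \<le> ln (4 * real_of_int T ^ 4 * real_of_int (B n) ^ 4)"
    unfolding h_def using p T_pos by (subst ln_le_cancel_iff) auto
  also have "\<dots> = ln 4 + 4 * ln (real_of_int T) + 4 * ln (real_of_int (B n))"
    using p T_pos by (simp add: ln_mult ln_realpow)
  finally show ?thesis using ln_T_upper ln_4 by argo
qed

lemma primitive_divisor_even:
  assumes "even n" "12 \<le> n"
  shows "\<exists>p. primitive_divisor B n p"
proof (rule ccontr)
  assume np: "\<not> ?thesis"
  obtain m where m: "n = 2 * m" using assms by blast
  obtain r where r: "X n = r\<^sup>2" using double_squares(1)[of m] assms m by auto
  note b = even_numeric_bound[OF assms]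
  have n0: "0 < n" using assms by simp
  \<comment> \<open>The left side of the numeric bound is nonnegative, so the bound itself supplies
    the condition on \<open>inverse_square_sum n\<close>.\<close>
  have "0 \<le> 2 / 3 * ln (real n) + real (card (prime_factors n)) / 2 + 1" using n0 by simp
  then have "0 < (real n)\<^sup>2 * (1 / 8 - inverse_square_sum n / 4)" using b by linarith
  then have "inverse_square_sum n / 4 \<le> 1 / 8" by (simp add: zero_less_mult_iff)
  from no_primitive_divisor_bound[OF n0 np ln_B_lower_if_square[OF n0 r] this] b
  show False by linarith
qed

lemma primitive_divisor_odd_if_negative:
  assumes "X 1 < 0" "odd n" "5 \<le> n"
  shows "\<exists>p. primitive_divisor B n p"
proof (rule ccontr)
  assume np: "\<not> ?thesis"
  have n0: "0 < n" using assms by simp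
  have "inverse_square_sum n / 4 \<le> 1 / 4" using inverse_square_sum_odd[OF assms(2)] by simp
  from no_primitive_divisor_bound[OF n0 np ln_B_lower_if_negative[OF n0 odd_multiple_negative[OF assms(1,2)]] this]
    odd_numeric_bound(1)[OF assms(2,3)]
  show False by linarith
qed

lemma primitive_divisor_odd_if_square:
  assumes "X 1 = q\<^sup>2" "odd n" "23 \<le> n"
  shows "\<exists>p. primitive_divisor B n p"
proof (rule ccontr)
  assume np: "\<not> ?thesis"
  obtain r where r: "X n = r\<^sup>2" using odd_multiple_of_square[OF assms(1,2)] by blast
  have n0: "0 < n" using assms by simp
  have "inverse_square_sum n / 4 \<le> 1 / 8" using inverse_square_sum_odd[OF assms(2)] by simp
  from no_primitive_divisor_bound[OF n0 np ln_B_lower_if_square[OF n0 r] this]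
    odd_numeric_bound(2)[OF assms(2,3)]
  show False by linarith
qed

end

section \<open>From primitive divisors to the Zsigmondy bounds\<close>

lemma max_or_infinity_le:
  assumes "\<And>n. n \<in> S \<Longrightarrow> n \<le> N"
  shows "max_or_infinity S \<le> enat N"
proof -
  have "finite S" using assms finite_nat_set_iff_bounded_le by blast
  then show ?thesis using assms by (simp add: max_or_infinity_def zero_enat_def)
qed

theorem theorem2p2:
  fixes T :: int and E :: "rat weierstrass" and P :: "rat point"
  assumes "T > 0" and "squarefree T"
    and "E = congruent_number_curve T"
    and "on_curve E P" and "\<not> torsion E P"
  shows "zsigmondy_even (ell_div_seq E P) \<le> 10
    \<and> (x_coord P < 0 \<longrightarrow> zsigmondy_odd (ell_div_seq E P) \<le> 3)
    \<and> ((\<exists>q::rat. x_coord P = q^2) \<longrightarrow> zsigmondy_odd (ell_div_seq E P) \<le> 21)"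
proof -
  interpret C: squarefree_congruent_point T P
    using assms by unfold_locales auto
  have B: "ell_div_seq E P = C.B" by (simp add: C.B_def assms(3))
  have X1: "C.X 1 = x_coord P" by (simp add: C.X_def C.Q_1[unfolded One_nat_def])
  have "zsigmondy_even C.B \<le> enat 10"
    unfolding zsigmondy_even_def
  proof (rule max_or_infinity_le)
    fix n assume "n \<in> {2 * n | n. 1 \<le> n \<and> \<not> (\<exists>p. primitive_divisor C.B (2 * n) p)}"
    then have "even n" "\<not> (\<exists>p. primitive_divisor C.B n p)" by auto
    then have "\<not> 12 \<le> n" using C.primitive_divisor_even by blast
    \<comment> \<open>Parity excludes 11; the two odd cases below pass over 4 and 22 in the same
      way.\<close>
    then show "n \<le> 10" using \<open>even n\<close> by presburger
  qed
  moreover have "zsigmondy_odd C.B \<le> enat 3" if "x_coord P < 0"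
    unfolding zsigmondy_odd_def
  proof (rule max_or_infinity_le)
    fix n assume "n \<in> {2 * n - 1 | n. 1 \<le> n \<and> \<not> (\<exists>p. primitive_divisor C.B (2 * n - 1) p)}"
    then have "odd n" "\<not> (\<exists>p. primitive_divisor C.B n p)" by auto
    then have "\<not> 5 \<le> n" using C.primitive_divisor_odd_if_negative that X1 by metis
    then show "n \<le> 3" using \<open>odd n\<close> by presburger
  qed
  moreover have "zsigmondy_odd C.B \<le> enat 21" if "\<exists>q. x_coord P = q\<^sup>2"
    unfolding zsigmondy_odd_def
  proof (rule max_or_infinity_le)
    fix n assume "n \<in> {2 * n - 1 | n. 1 \<le> n \<and> \<not> (\<exists>p. primitive_divisor C.B (2 * n - 1) p)}"
    then have "odd n" "\<not> (\<exists>p. primitive_divisor C.B n p)" by auto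
    then have "\<not> 23 \<le> n" using C.primitive_divisor_odd_if_square that X1 by metis
    then show "n \<le> 21" using \<open>odd n\<close> by presburger
  qed
  ultimately show ?thesis unfolding B by (simp add: numeral_eq_enat)
qed

end
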